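(* Let $(\Omega,R_\ast)$ be a polycrystal, let $\Omega_1,\ldots,\Omega_M$ with $M\in\mathbb N$ be the boundary grains of $(\Omega,R_\ast)$, and let $J\subset\{1,\ldots,M\}$ be the set of all indices $i$ such that there exists $x_i\in\partial\Omega_i\cap\partial(\Omega,R_\ast)$ with $\nu(x_i)\cdot R_\ast|_{\Omega_i}e_1=0$. Then $$\mathcal F_{\mathcal M}(\Omega,R_\ast)\subset\bigcap_{i\in J}\mathcal N R_\ast^T|_{\Omega_i}.$$ (If $J=\emptyset$, the intersection is understood as $\mathbb R^{2\times 2}$.)
   Context: Notation: $e_1,e_2$ is the standard basis of $\mathbb R^2$, $|\cdot|$ the Euclidean norm, $$\mathcal M:=\{F\in\mathbb R^{2\times 2}:\det F=1,\ |Fe_1|=1\},\qquad \mathcal N:=\{F\in\mathbb R^{2\times 2}:\det F=1,\ |Fe_1|\leq 1\},$$ and for $R\in\mathrm{SO}(2)$, $\mathcal M R^T=\{FR^T:F\in\mathcal M\}$, $\mathcal N R^T=\{FR^T:F\in\mathcal N\}$; $R_\ast^T|_{\Omega_i}$ is the transpose of the constant value of $R_\ast$ on $\Omega_i$. Polycrystal: a pair $(\Omega,R_\ast)$ such that $\Omega\subset\mathbb R^2$ is a bounded Lipschitz domain with a partition (up to a set of measure zero) into finitely many bounded Lipschitz domains $\Omega_1,\ldots,\Omega_N\subset\Omega$ (the grains), i.e. $\Omega=\mathrm{int}\bigcup_{k=1}^N\overline{\Omega}_k$ and $\mathrm{int}\,\overline{\Omega}_k=\Omega_k$ for all $k$;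 and $R_\ast:\Omega\to\mathrm{SO}(2)$ is constant on each $\Omega_k$, with $R_\ast|_{\Omega_k}\neq\pm R_\ast|_{\Omega_l}$ whenever $k\neq l$ and $\mathcal H^1(\partial\Omega_k\cap\partial\Omega_l)>0$ ($\mathcal H^1$ the one-dimensional Hausdorff measure). A grain $\Omega_k$ is interior if $\partial\Omega_k\subset\bigcup_{l\neq k}\partial\Omega_l$; all other grains are boundary grains. The boundary dual points are the points of $\bigcup_{1\le k<l\le N}\partial\Omega_k\cap\partial\Omega_l\cap\partial\Omega$. With $\nu$ the outer unit normal of $\Omega$, $$\partial(\Omega,R_\ast):=\{x\in\partial\Omega:\nu(x)\text{ exists and }x\text{ is not a boundary dual point}\}.$$ Attainable macroscopic strains: $\mathcal F_{\mathcal M}(\Omega,R_\ast)$ is the set of all $F\in\mathbb R^{2\times 2}$ for which there is $u\in W^{1,\infty}(\Omega;\mathbb R^2)$ with $\nabla u(x)\in\mathcal M R_\ast^T(x)$ for a.e. $x\in\Omega$ and $u(x)=Fx$ for $x\in\partial\Omega$. *)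

theory Defs
  imports "HOL-Analysis.Analysis"
begin

type_synonym plane = "real ^ 2"
type_synonym mat2 = "real ^ 2 ^ 2"

abbreviation e1 :: plane where "e1 \<equiv> axis 1 1"

definition SO2 :: "mat2 set" where
  "SO2 = {Q. rotation_matrix Q}"

definition M_set :: "mat2 set" where
  "M_set = {F. det F = 1 \<and> norm (F *v e1) = 1}"

definition N_set :: "mat2 set" where
  "N_set = {F. det F = 1 \<and> norm (F *v e1) \<le> 1}"

definition rotated :: "mat2 set \<Rightarrow> mat2 \<Rightarrow> mat2 set" where
  "rotated S Q = {F ** transpose Q | F. F \<in> S}"


(* Near x0, in the coordinates Q x (a reorientation of the axes), the set is the part of a ball
   lying strictly above the graph of a Lipschitz function g. *)
definition lipschitz_chart ::
  "plane set \<Rightarrow> plane \<Rightarrow> mat2 \<Rightarrow> real \<Rightarrow> (real \<Rightarrow> real) \<Rightarrow> bool" where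
  "lipschitz_chart \<Omega> x0 Q r g \<longleftrightarrow>
     orthogonal_matrix Q \<and> r > 0 \<and> (\<exists>L. L-lipschitz_on UNIV g) \<and>
     \<Omega> \<inter> ball x0 r = {x \<in> ball x0 r. (Q *v x) $ 2 > g ((Q *v x) $ 1)}"

definition bounded_lipschitz_domain :: "plane set \<Rightarrow> bool" where
  "bounded_lipschitz_domain \<Omega> \<longleftrightarrow>
     open \<Omega> \<and> connected \<Omega> \<and> \<Omega> \<noteq> {} \<and> bounded \<Omega> \<and>
     (\<forall>x0\<in>frontier \<Omega>. \<exists>Q r g. lipschitz_chart \<Omega> x0 Q r g)"

(* n is the outer unit normal at the boundary point x: the graph function of a chart around x is
   differentiable at the abscissa of x, with slope d, and n is (d, -1) / sqrt (1 + d^2)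
   transformed back from the chart coordinates. "nu(x) exists" means that such an n exists. *)
definition outer_unit_normal_at :: "plane set \<Rightarrow> plane \<Rightarrow> plane \<Rightarrow> bool" where
  "outer_unit_normal_at \<Omega> x n \<longleftrightarrow>
     x \<in> frontier \<Omega> \<and>
     (\<exists>Q r g d. lipschitz_chart \<Omega> x Q r g \<and>
        (g has_real_derivative d) (at ((Q *v x) $ 1)) \<and>
        n = transpose Q *v ((1 / sqrt (1 + d\<^sup>2)) *\<^sub>R vector [d, -1]))"


(* The covering sets are required to be bounded because diameter is unspecified on unbounded
   sets. *)
definition hausdorff1_pre :: "real \<Rightarrow> 'a::metric_space set \<Rightarrow> ennreal" where
  "hausdorff1_pre \<delta> A =
     (INF U \<in> {U :: nat \<Rightarrow> 'a set. A \<subseteq> (\<Union>n. U n) \<and> (\<forall>n. bounded (U n) \<and> diameter (U n) \<le> \<delta>)}.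
        (\<Sum>n. ennreal (diameter (U n))))"

definition hausdorff1 :: "'a::metric_space set \<Rightarrow> ennreal" where
  "hausdorff1 A = (SUP \<delta>\<in>{0<..}. hausdorff1_pre \<delta> A)"


(* The constant value of f on A; meaningful if A is nonempty and f is constant on A. *)
definition value_on :: "('a \<Rightarrow> 'b) \<Rightarrow> 'a set \<Rightarrow> 'b" where
  "value_on f A = (THE y. \<forall>x\<in>A. f x = y)"

(* The grains G 1, ..., G N are made explicit; only the values of R on \<Omega> matter. *)
definition polycrystal ::
  "plane set \<Rightarrow> (plane \<Rightarrow> mat2) \<Rightarrow> nat \<Rightarrow> (nat \<Rightarrow> plane set) \<Rightarrow> bool" where
  "polycrystal \<Omega> R N G \<longleftrightarrow>
     bounded_lipschitz_domain \<Omega> \<and>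
     (\<forall>k\<in>{1..N}. bounded_lipschitz_domain (G k) \<and> G k \<subseteq> \<Omega>) \<and>
     disjoint_family_on G {1..N} \<and>
     negligible (\<Omega> - (\<Union>k\<in>{1..N}. G k)) \<and>
     \<Omega> = interior (\<Union>k\<in>{1..N}. closure (G k)) \<and>
     (\<forall>k\<in>{1..N}. interior (closure (G k)) = G k) \<and>
     (\<forall>x\<in>\<Omega>. R x \<in> SO2) \<and>
     (\<forall>k\<in>{1..N}. R constant_on G k) \<and>
     (\<forall>k\<in>{1..N}. \<forall>l\<in>{1..N}.
        k \<noteq> l \<and> hausdorff1 (frontier (G k) \<inter> frontier (G l)) > 0 \<longrightarrow>
        value_on R (G k) \<noteq> value_on R (G l) \<and> value_on R (G k) \<noteq> - value_on R (G l))"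

definition interior_grain :: "nat \<Rightarrow> (nat \<Rightarrow> plane set) \<Rightarrow> nat \<Rightarrow> bool" where
  "interior_grain N G k \<longleftrightarrow> frontier (G k) \<subseteq> (\<Union>l\<in>{1..N} - {k}. frontier (G l))"

definition boundary_grains :: "nat \<Rightarrow> (nat \<Rightarrow> plane set) \<Rightarrow> nat set" where
  "boundary_grains N G = {k \<in> {1..N}. \<not> interior_grain N G k}"

definition boundary_dual_points :: "plane set \<Rightarrow> nat \<Rightarrow> (nat \<Rightarrow> plane set) \<Rightarrow> plane set" where
  "boundary_dual_points \<Omega> N G =
     {x. \<exists>k l. 1 \<le> k \<and> k < l \<and> l \<le> N \<and> x \<in> frontier (G k) \<inter> frontier (G l) \<inter> frontier \<Omega>}"

definition polycrystal_boundary :: "plane set \<Rightarrow> nat \<Rightarrow> (nat \<Rightarrow> plane set) \<Rightarrow> plane set" where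
  "polycrystal_boundary \<Omega> N G =
     {x \<in> frontier \<Omega>. (\<exists>n. outer_unit_normal_at \<Omega> x n) \<and> x \<notin> boundary_dual_points \<Omega> N G}"


(* D j is the j-th partial derivative of f. *)
primrec C_k :: "nat \<Rightarrow> (plane \<Rightarrow> real) \<Rightarrow> bool" where
  "C_k 0 f \<longleftrightarrow> continuous_on UNIV f"
| "C_k (Suc k) f \<longleftrightarrow>
     (\<exists>D :: 2 \<Rightarrow> plane \<Rightarrow> real.
        (\<forall>x. (f has_derivative (\<lambda>h. \<Sum>j\<in>UNIV. D j x * h $ j)) (at x)) \<and> (\<forall>j. C_k k (D j)))"

definition test_function :: "plane set \<Rightarrow> (plane \<Rightarrow> real) \<Rightarrow> bool" where
  "test_function \<Omega> \<phi> \<longleftrightarrow>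
     (\<forall>k. C_k k \<phi>) \<and>
     compact (closure {x. \<phi> x \<noteq> 0}) \<and> closure {x. \<phi> x \<noteq> 0} \<subseteq> \<Omega>"

definition partial_deriv :: "2 \<Rightarrow> (plane \<Rightarrow> real) \<Rightarrow> plane \<Rightarrow> real" where
  "partial_deriv j \<phi> x = frechet_derivative \<phi> (at x) (axis j 1)"

definition L_infinity :: "plane set \<Rightarrow> (plane \<Rightarrow> 'b::euclidean_space) \<Rightarrow> bool" where
  "L_infinity \<Omega> f \<longleftrightarrow>
     f \<in> borel_measurable (lebesgue_on \<Omega>) \<and> (\<exists>C. AE x in lebesgue_on \<Omega>. norm (f x) \<le> C)"

definition weak_gradient :: "plane set \<Rightarrow> (plane \<Rightarrow> plane) \<Rightarrow> (plane \<Rightarrow> mat2) \<Rightarrow> bool" where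
  "weak_gradient \<Omega> u Du \<longleftrightarrow>
     (\<forall>\<phi> i j. test_function \<Omega> \<phi> \<longrightarrow>
        integral\<^sup>L (lebesgue_on \<Omega>) (\<lambda>x. u x $ i * partial_deriv j \<phi> x) =
        - integral\<^sup>L (lebesgue_on \<Omega>) (\<lambda>x. Du x $ i $ j * \<phi> x))"

(* u belongs to the Sobolev space W^{1,infinity}(\<Omega>; R^2), with weak gradient Du. *)
definition W1_infinity :: "plane set \<Rightarrow> (plane \<Rightarrow> plane) \<Rightarrow> (plane \<Rightarrow> mat2) \<Rightarrow> bool" where
  "W1_infinity \<Omega> u Du \<longleftrightarrow> L_infinity \<Omega> u \<and> L_infinity \<Omega> Du \<and> weak_gradient \<Omega> u Du"

(* Elements of W^{1,infinity} on a bounded Lipschitz domain have a representative that is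
   continuous up to the boundary; boundary values are those of this representative. *)
definition boundary_values :: "plane set \<Rightarrow> (plane \<Rightarrow> plane) \<Rightarrow> (plane \<Rightarrow> plane) \<Rightarrow> bool" where
  "boundary_values \<Omega> u f \<longleftrightarrow>
     (\<exists>v. continuous_on (closure \<Omega>) v \<and> (AE x in lebesgue_on \<Omega>. v x = u x) \<and>
          (\<forall>x\<in>frontier \<Omega>. v x = f x))"

definition attainable_strains :: "plane set \<Rightarrow> (plane \<Rightarrow> mat2) \<Rightarrow> mat2 set" where
  "attainable_strains \<Omega> R =
     {F. \<exists>u Du. W1_infinity \<Omega> u Du \<and>
           (AE x in lebesgue_on \<Omega>. Du x \<in> rotated M_set (R x)) \<and>
           boundary_values \<Omega> u (\<lambda>x. F *v x)}"

end

theory Submission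
  imports Defs
begin

text \<open>
  If $u$ has boundary values $Fx$, then $w = u - Fx$, extended by zero, is globally Lipschitz. Its difference
  quotients converge weakly to the weak gradient. Two difference quotients in different directions can be
  exchanged under the integral by translation invariance, so in the limit the Jacobian of $w$ integrates to
  zero, and $\det F = 1$ because $\det \nabla u = 1$ almost everywhere.

  For the norm bound, a tangent vector $\tau = R_* e_1$ at the boundary point lets one place segments in
  direction $\tau$ inside the single grain touching that point. There $|\nabla u\, \tau| = 1$, so $u$ is
  1-Lipschitz along the segment. The segment of length $t$ is at distance $o(t)$ from boundary points at which
  $u(x) = Fx$; letting $t \to 0$ gives $|F \tau| \le 1$.
\<close>

text \<open>The gradient is known only through integration by parts against smooth functions. What
  replaces pointwise differentiation is the integral of f(y) phi(y - s tau), seen as a function of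
  s: the shift falls on phi, so it is differentiable in the classical sense, and its derivative is
  the integral of the weak derivative along tau against the shifted phi. Both the estimates along
  segments and the limits of difference quotients come from this one fact.

  The Jacobian contains products of two weak limits, and a product of weakly convergent sequences
  need not converge to the product of the limits. Hence the two step sizes are sent to zero one
  after the other, and weak convergence is established against every bounded measurable multiplier:
  in the second limit the multiplier is itself a weak derivative. Approximation of bounded functions
  by test functions in L^1 supplies this.

  The set \<open>M_set\<close> prescribes the length of the image of one direction only, and the
  boundary values control u along the boundary only. The norm bound therefore asks that this
  direction be tangent.\<close>

subsection \<open>Smooth test functions\<close>

text \<open>The functions $p(1/x)\, e^{-1/x}$, extended by zero to $x \le 0$, are closed under differentiation,
  so each of them is smooth.\<close>

definition flat_exp_deriv :: "real poly \<Rightarrow> real \<Rightarrow> real" where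
  "flat_exp_deriv p x = (if x > 0 then poly p (1 / x) * exp (- 1 / x) else 0)"

lemma poly_times_exp_tendsto_0:
  fixes p :: "real poly"
  shows "((\<lambda>x. poly p x * exp (- x)) \<longlongrightarrow> 0) at_top"
proof -
  have "((\<lambda>x. \<Sum>i\<le>degree p. coeff p i * (x ^ i / exp x)) \<longlongrightarrow> (\<Sum>i\<le>degree p. coeff p i * 0)) at_top"
    by (intro tendsto_intros tendsto_power_div_exp_0)
  then show ?thesis
    by (simp add: poly_altdef sum_distrib_right exp_minus divide_inverse mult.assoc)
qed

text \<open>In the variable t = 1/x the operator d/dx is -t^2 d/dt, which turns p(t) e^(-t) into t^2
  (p(t) - p'(t)) e^(-t). This is where the polynomial \<open>[:0, 0, 1:] * (p - pderiv p)\<close>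
  comes from.\<close>

lemma flat_exp_deriv_has_derivative:
  "(flat_exp_deriv p has_real_derivative flat_exp_deriv ([:0, 0, 1:] * (p - pderiv p)) x) (at x)"
proof -
  consider "x > 0" | "x < 0" | "x = 0" by linarith
  then show ?thesis
  proof cases
    case 1
    have inv: "((\<lambda>x. 1 / x) has_real_derivative - (1 / x * (1 / x))) (at x)"
      using 1 by (auto intro!: derivative_eq_intros)
    have "((\<lambda>x. poly p (1 / x) * exp (- (1 / x))) has_real_derivative
        poly p (1 / x) * (exp (- (1 / x)) * - (- (1 / x * (1 / x))))
          + poly (pderiv p) (1 / x) * - (1 / x * (1 / x)) * exp (- (1 / x))) (at x)"
      by (rule DERIV_mult' DERIV_chain'[OF inv poly_DERIV] DERIV_fun_exp DERIV_minus inv)+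
    moreover have "poly p (1 / x) * (exp (- (1 / x)) * - (- (1 / x * (1 / x))))
          + poly (pderiv p) (1 / x) * - (1 / x * (1 / x)) * exp (- (1 / x))
        = flat_exp_deriv ([:0, 0, 1:] * (p - pderiv p)) x"
      using 1 by (simp add: flat_exp_deriv_def algebra_simps)
    ultimately have d: "((\<lambda>x. poly p (1 / x) * exp (- 1 / x)) has_real_derivative
        flat_exp_deriv ([:0, 0, 1:] * (p - pderiv p)) x) (at x)"
      by simp
    have ev: "\<forall>\<^sub>F y in nhds x. flat_exp_deriv p y = poly p (1 / y) * exp (- 1 / y)"
      using 1 by (intro eventually_mono[OF eventually_nhds_in_open[of "{0<..}" x]])
        (auto simp: flat_exp_deriv_def)
    show ?thesis
      by (rule iffD2[OF DERIV_cong_ev[OF refl ev refl] d])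
  next
    case 2
    have ev: "\<forall>\<^sub>F y in nhds x. flat_exp_deriv p y = 0"
      using 2 by (intro eventually_mono[OF eventually_nhds_in_open[of "{..<0}" x]])
        (auto simp: flat_exp_deriv_def)
    have d: "((\<lambda>x. 0) has_real_derivative flat_exp_deriv ([:0, 0, 1:] * (p - pderiv p)) x) (at x)"
      using 2 by (simp add: flat_exp_deriv_def)
    show ?thesis
      by (rule iffD2[OF DERIV_cong_ev[OF refl ev refl] d])
  next
    case 3
    have "((\<lambda>h. flat_exp_deriv p h / h) \<longlongrightarrow> 0) (at_right 0)"
    proof -
      \<comment> \<open>The factor 1/h of the difference quotient at 0 is absorbed into the
        polynomial, so the decay of any polynomial times e^(-t) is enough.\<close>
      have "((\<lambda>h. poly ([:0, 1:] * p) (inverse h) * exp (- inverse h)) \<longlongrightarrow> 0) (at_right (0::real))"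
        by (rule filterlim_compose[OF poly_times_exp_tendsto_0 filterlim_inverse_at_top_right])
      then show ?thesis
        by (rule Lim_transform_eventually)
          (auto simp: flat_exp_deriv_def eventually_at_filter divide_inverse)
    qed
    moreover have "((\<lambda>h. flat_exp_deriv p h / h) \<longlongrightarrow> 0) (at_left 0)"
      by (rule tendsto_eventually) (auto simp: flat_exp_deriv_def eventually_at_filter)
    ultimately have "((\<lambda>h. flat_exp_deriv p h / h) \<longlongrightarrow> 0) (at 0)"
      using filterlim_split_at by blast
    then show ?thesis
      using 3 by (simp add: DERIV_def flat_exp_deriv_def)
  qed
qed

definition flat_exp :: "real \<Rightarrow> real" where
  "flat_exp = flat_exp_deriv 1"

lemma flat_exp_nonneg: "0 \<le> flat_exp x"
  and flat_exp_pos_iff: "0 < flat_exp x \<longleftrightarrow> 0 < x"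
  by (auto simp: flat_exp_def flat_exp_deriv_def)

lemma C_k_const: "C_k k (\<lambda>x. c)"
proof (induction k arbitrary: c)
  case (Suc k)
  show ?case
    unfolding C_k.simps by (rule exI[of _ "\<lambda>j x. 0"]) (use Suc in auto)
qed simp

lemma C_k_component: "C_k k (\<lambda>x::plane. x $ i)"
proof (cases k)
  case 0
  then show ?thesis by (simp add: continuous_on_component)
next
  case (Suc n)
  have "((\<lambda>x::plane. x $ i) has_derivative (\<lambda>h. \<Sum>j\<in>UNIV. (if j = i then 1 else 0) * h $ j)) (at x)" for x
    by (rule has_derivative_eq_rhs[OF bounded_linear_imp_has_derivative[OF bounded_linear_vec_nth[of i]]])
      (auto simp: fun_eq_iff if_distribR if_distrib[of "\<lambda>t. t * _"] cong: if_cong)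
  then show ?thesis
    unfolding Suc C_k.simps by (intro exI[of _ "\<lambda>j x. if j = i then 1 else 0"]) (auto intro: C_k_const)
qed

lemma C_k_add: "C_k k f \<Longrightarrow> C_k k g \<Longrightarrow> C_k k (\<lambda>x. f x + g x)"
proof (induction k arbitrary: f g)
  case 0
  then show ?case by (simp add: continuous_on_add)
next
  case (Suc k)
  obtain D E where
    "\<And>x. (f has_derivative (\<lambda>h. \<Sum>j\<in>UNIV. D j x * h $ j)) (at x)" "\<And>j. C_k k (D j)"
    "\<And>x. (g has_derivative (\<lambda>h. \<Sum>j\<in>UNIV. E j x * h $ j)) (at x)" "\<And>j. C_k k (E j)"
    using Suc.prems by auto
  then show ?case
    unfolding C_k.simps
    by (intro exI[of _ "\<lambda>j x. D j x + E j x"])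
      (auto intro!: Suc.IH derivative_eq_intros simp: algebra_simps sum.distrib)
qed

text \<open>In the product and chain rules some factors remain undifferentiated. They are of class
  C^(k+1), while the induction hypothesis speaks of class C^k.\<close>

lemma C_k_Suc_imp_C_k: "C_k (Suc k) f \<Longrightarrow> C_k k f"
proof (induction k arbitrary: f)
  case 0
  then show ?case
    by (auto intro: has_derivative_continuous_on has_derivative_at_withinI)
next
  case (Suc k)
  then obtain D where "\<And>x. (f has_derivative (\<lambda>h. \<Sum>j\<in>UNIV. D j x * h $ j)) (at x)"
    "\<And>j. C_k (Suc k) (D j)"
    using C_k.simps(2) by blast
  then show ?case
    unfolding C_k.simps(2)[of k f] using Suc.IH by blast
qed

lemma C_k_mult: "C_k k f \<Longrightarrow> C_k k g \<Longrightarrow> C_k k (\<lambda>x. f x * g x)"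
proof (induction k arbitrary: f g)
  case 0
  then show ?case by (simp add: continuous_on_mult)
next
  case (Suc k)
  obtain D E where
    D: "\<And>x. (f has_derivative (\<lambda>h. \<Sum>j\<in>UNIV. D j x * h $ j)) (at x)" "\<And>j. C_k k (D j)" and
    E: "\<And>x. (g has_derivative (\<lambda>h. \<Sum>j\<in>UNIV. E j x * h $ j)) (at x)" "\<And>j. C_k k (E j)"
    using Suc.prems by auto
  have "((\<lambda>x. f x * g x) has_derivative (\<lambda>h. \<Sum>j\<in>UNIV. (f x * E j x + D j x * g x) * h $ j)) (at x)" for x
    using D(1)[of x] E(1)[of x]
    by (auto intro!: derivative_eq_intros simp: algebra_simps sum.distrib sum_distrib_left)
  moreover have "C_k k (\<lambda>x. f x * E j x + D j x * g x)" for j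
    using C_k_Suc_imp_C_k[OF Suc.prems(1)] C_k_Suc_imp_C_k[OF Suc.prems(2)] D(2) E(2)
    by (intro C_k_add Suc.IH)
  ultimately show ?case
    unfolding C_k.simps by (intro exI[of _ "\<lambda>j x. f x * E j x + D j x * g x"]) auto
qed

lemma C_k_sum: "finite I \<Longrightarrow> (\<And>i. i \<in> I \<Longrightarrow> C_k k (f i)) \<Longrightarrow> C_k k (\<lambda>x. \<Sum>i\<in>I. f i x)"
  by (induction I rule: finite_induct) (auto intro: C_k_const C_k_add)

text \<open>Differentiation replaces \<open>p\<close> by another polynomial, so the induction must
  run over all polynomials at once; \<open>flat_exp\<close> alone would not do.\<close>

lemma C_k_flat_exp_deriv: "C_k k f \<Longrightarrow> C_k k (\<lambda>x. flat_exp_deriv p (f x))"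
proof (induction k arbitrary: f p)
  case 0
  have "continuous_on UNIV (flat_exp_deriv p)"
    using flat_exp_deriv_has_derivative DERIV_continuous_on by blast
  then show ?case
    using 0 continuous_on_compose2 by fastforce
next
  case (Suc k)
  let ?q = "[:0, 0, 1:] * (p - pderiv p)"
  obtain D where
    D: "\<And>x. (f has_derivative (\<lambda>h. \<Sum>j\<in>UNIV. D j x * h $ j)) (at x)" "\<And>j. C_k k (D j)"
    using Suc.prems by auto
  have "((\<lambda>x. flat_exp_deriv p (f x)) has_derivative
      (\<lambda>h. \<Sum>j\<in>UNIV. (flat_exp_deriv ?q (f x) * D j x) * h $ j)) (at x)" for x
    using has_derivative_compose[OF D(1)[of x]
        flat_exp_deriv_has_derivative[of p "f x", unfolded has_field_derivative_def]]
    by (simp only: sum_distrib_left mult.assoc)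
  moreover have "C_k k (\<lambda>x. flat_exp_deriv ?q (f x) * D j x)" for j
    using C_k_Suc_imp_C_k[OF Suc.prems] D(2) by (intro C_k_mult Suc.IH)
  ultimately show ?case
    unfolding C_k.simps by (intro exI[of _ "\<lambda>j x. flat_exp_deriv ?q (f x) * D j x"]) auto
qed

text \<open>Makes the polynomials that Stone-Weierstrass provides available as smooth factors of
  test functions.\<close>

lemma C_k_real_polynomial_function:
  fixes p :: "plane \<Rightarrow> real"
  assumes "real_polynomial_function p"
  shows "C_k k p"
  using assms
proof (induction p rule: real_polynomial_function.induct)
  case (linear f)
  then interpret bounded_linear f .
  have "f = (\<lambda>x. \<Sum>i\<in>UNIV. f (axis i 1) * x $ i)"
  proof
    fix x :: plane
    have "x = (\<Sum>i\<in>UNIV. x $ i *\<^sub>R axis i 1)"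
      by (simp add: vec_eq_iff axis_def if_distrib cong: if_cong)
    then have "f x = f (\<Sum>i\<in>UNIV. x $ i *\<^sub>R axis i 1)" by simp
    then show "f x = (\<Sum>i\<in>UNIV. f (axis i 1) * x $ i)"
      by (simp add: sum scaleR mult.commute)
  qed
  moreover have "C_k k (\<lambda>x. \<Sum>i\<in>UNIV. f (axis i 1) * x $ i)"
    by (intro C_k_sum C_k_mult C_k_const C_k_component) auto
  ultimately show ?case by simp
qed (auto intro: C_k_const C_k_add C_k_mult)

text \<open>The squared norm is a polynomial in the coordinates and hence smooth at the centre too.
  The bump is not normalised; its mass \<open>integral\<^sup>L lebesgue (bump 0 r)\<close> is
  carried through the estimates instead.\<close>

definition bump :: "plane \<Rightarrow> real \<Rightarrow> plane \<Rightarrow> real" where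
  "bump c r x = flat_exp (r\<^sup>2 - (norm (x - c))\<^sup>2)"

lemma bump_nonneg: "0 \<le> bump c r x"
  by (simp add: bump_def flat_exp_nonneg)

lemma bump_pos_iff:
  assumes "r \<ge> 0"
  shows "0 < bump c r x \<longleftrightarrow> x \<in> ball c r"
proof -
  have "(norm (x - c))\<^sup>2 < r\<^sup>2 \<longleftrightarrow> norm (x - c) < r"
    using assms power2_less_imp_less[of "norm (x - c)" r] power_strict_mono[of "norm (x - c)" r 2]
    by (metis norm_ge_zero pos2)
  then show ?thesis
    by (simp add: bump_def flat_exp_pos_iff dist_norm norm_minus_commute)
qed

lemma bump_eq_0: "r \<ge> 0 \<Longrightarrow> x \<notin> ball c r \<Longrightarrow> bump c r x = 0"
  using bump_pos_iff[of r c x] bump_nonneg[of c r x] by linarith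

lemma bump_translate: "bump c r (x - a) = bump (c + a) r x"
  by (simp add: bump_def algebra_simps)

lemma C_k_bump: "C_k k (bump c r)"
proof -
  have "bump c r = (\<lambda>x. flat_exp_deriv 1 (r\<^sup>2 + (- 1) * (\<Sum>i\<in>UNIV. (x $ i + (- c $ i)) * (x $ i + (- c $ i)))))"
  proof
    fix x
    have "(norm (x - c))\<^sup>2 = (\<Sum>i\<in>UNIV. (x $ i + (- c $ i)) * (x $ i + (- c $ i)))"
      unfolding power2_norm_eq_inner inner_vec_def by simp
    then show "bump c r x = flat_exp_deriv 1 (r\<^sup>2 + (- 1) * (\<Sum>i\<in>UNIV. (x $ i + (- c $ i)) * (x $ i + (- c $ i))))"
      unfolding bump_def flat_exp_def by simp
  qed
  moreover have "C_k k (\<lambda>x. flat_exp_deriv 1 (r\<^sup>2 + (- 1) * (\<Sum>i\<in>UNIV. (x $ i + (- c $ i)) * (x $ i + (- c $ i)))))"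
    by (intro C_k_flat_exp_deriv C_k_add C_k_mult C_k_sum C_k_const C_k_component) simp
  ultimately show ?thesis by (simp only:)
qed

text \<open>The bumps alone provide the compact support, so \<open>p\<close> can be any smooth
  function, for instance a polynomial.\<close>

lemma test_function_sum_bump:
  assumes "finite I" and "\<And>i. i \<in> I \<Longrightarrow> r i \<ge> 0" and "\<And>i. i \<in> I \<Longrightarrow> cball (c i) (r i) \<subseteq> \<Omega>"
    and "\<And>k. C_k k p"
  shows "test_function \<Omega> (\<lambda>x. (\<Sum>i\<in>I. bump (c i) (r i) x) * p x)"
proof -
  let ?K = "\<Union>i\<in>I. cball (c i) (r i)"
  have "{x. (\<Sum>i\<in>I. bump (c i) (r i) x) * p x \<noteq> 0} \<subseteq> ?K"
  proof
    fix x assume "x \<in> {x. (\<Sum>i\<in>I. bump (c i) (r i) x) * p x \<noteq> 0}"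
    then obtain i where "i \<in> I" "bump (c i) (r i) x \<noteq> 0"
      using sum.neutral by force
    then show "x \<in> ?K"
      using bump_eq_0[of "r i" x "c i"] assms(2) ball_subset_cball by blast
  qed
  moreover have "compact ?K"
    using assms(1) by (intro compact_UN) auto
  ultimately have "closure {x. (\<Sum>i\<in>I. bump (c i) (r i) x) * p x \<noteq> 0} \<subseteq> ?K"
    and "compact (closure {x. (\<Sum>i\<in>I. bump (c i) (r i) x) * p x \<noteq> 0})"
    by (auto simp: closure_minimal compact_imp_closed dest: bounded_subset[OF compact_imp_bounded])
  moreover have "C_k k (\<lambda>x. (\<Sum>i\<in>I. bump (c i) (r i) x) * p x)" for k
    using assms by (intro C_k_mult C_k_sum C_k_bump)
  ultimately show ?thesis
    using assms(3) unfolding test_function_def by blast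
qed

lemma test_function_bump:
  assumes "r \<ge> 0" and "cball c r \<subseteq> \<Omega>"
  shows "test_function \<Omega> (bump c r)"
  using test_function_sum_bump[of "{0::nat}" "\<lambda>_. r" "\<lambda>_. c" \<Omega> "\<lambda>_. 1"] assms
  by (simp add: C_k_const del: C_k.simps)

subsection \<open>Weak derivatives along segments\<close>

lemma has_derivative_test_function:
  assumes "test_function S \<phi>"
  shows "(\<phi> has_derivative frechet_derivative \<phi> (at x)) (at x)"
proof -
  have "C_k (Suc 0) \<phi>"
    using assms unfolding test_function_def by blast
  then have "\<phi> differentiable (at x)"
    by (auto simp: differentiable_def)
  then show ?thesis
    by (simp add: frechet_derivative_works)
qed

lemma continuous_on_test_function: "test_function S \<phi> \<Longrightarrow> continuous_on T \<phi>"
  by (rule has_derivative_continuous_on, rule has_derivative_at_withinI, rule has_derivative_test_function)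

lemma frechet_derivative_test_function:
  assumes "test_function S \<phi>"
  shows "frechet_derivative \<phi> (at x) \<tau> = (\<Sum>j\<in>UNIV. partial_deriv j \<phi> x * \<tau> $ j)"
proof -
  interpret linear "frechet_derivative \<phi> (at x)"
    using has_derivative_test_function[OF assms] by (rule has_derivative_linear)
  have \<tau>: "\<tau> = (\<Sum>i\<in>UNIV. \<tau> $ i *\<^sub>R axis i 1)"
    by (simp add: vec_eq_iff axis_def if_distrib cong: if_cong)
  have "frechet_derivative \<phi> (at x) \<tau> = frechet_derivative \<phi> (at x) (\<Sum>i\<in>UNIV. \<tau> $ i *\<^sub>R axis i 1)"
    by (rule arg_cong[OF \<tau>])
  then show ?thesis
    by (simp add: sum scaleR partial_deriv_def mult.commute)
qed

lemma continuous_on_partial_deriv: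
  assumes "test_function S \<phi>"
  shows "continuous_on UNIV (partial_deriv j \<phi>)"
proof -
  have "C_k (Suc 0) \<phi>"
    using assms unfolding test_function_def by blast
  then obtain D where D: "\<forall>x. (\<phi> has_derivative (\<lambda>h. \<Sum>j\<in>UNIV. D j x * h $ j)) (at x)"
    "\<forall>j. continuous_on UNIV (D j)"
    unfolding C_k.simps by (elim exE conjE)
  have "partial_deriv j \<phi> = D j"
  proof
    fix x
    show "partial_deriv j \<phi> x = D j x"
      unfolding partial_deriv_def frechet_derivative_at[OF D(1)[rule_format, of x], symmetric]
      by (simp add: axis_def if_distrib cong: if_cong)
  qed
  with D show ?thesis by simp
qed

lemma continuous_on_frechet_derivative_test_function:
  assumes "test_function S \<phi>"
  shows "continuous_on UNIV (\<lambda>x. frechet_derivative \<phi> (at x) \<tau>)"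
  unfolding frechet_derivative_test_function[OF assms]
  by (intro continuous_intros continuous_on_partial_deriv[OF assms])

text \<open>Off the closed support the function vanishes on a whole neighbourhood, so its derivative
  vanishes there as well and one compact set serves both.\<close>

lemma test_function_support:
  assumes "test_function S \<phi>"
  obtains K where "compact K" "K \<subseteq> S" "\<And>x. x \<notin> K \<Longrightarrow> \<phi> x = 0"
    "\<And>x \<tau>. x \<notin> K \<Longrightarrow> frechet_derivative \<phi> (at x) \<tau> = 0"
proof
  let ?K = "closure {x. \<phi> x \<noteq> 0}"
  show "compact ?K" "?K \<subseteq> S"
    using assms unfolding test_function_def by blast+
  show zero: "\<phi> x = 0" if "x \<notin> ?K" for x
    using that closure_subset[of "{x. \<phi> x \<noteq> 0}"] by blast
  show "frechet_derivative \<phi> (at x) \<tau> = 0" if "x \<notin> ?K" for x \<tau>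
  proof -
    have "(\<phi> has_derivative (\<lambda>h. 0)) (at x)"
    proof (rule has_derivative_transform_within_open)
      show "((\<lambda>h. 0) has_derivative (\<lambda>h. 0)) (at x)" by (rule has_derivative_const)
      show "x \<in> - ?K" using that by blast
      show "0 = \<phi> y" if "y \<in> - ?K" for y using zero that by (metis ComplD)
    qed (rule open_Compl[OF closed_closure])
    then show ?thesis
      using fun_cong[OF frechet_derivative_at, of \<phi> "\<lambda>h. 0" x \<tau>] by simp
  qed
qed

lemma frechet_derivative_translate:
  assumes "test_function S \<phi>"
  shows "frechet_derivative (\<lambda>y. \<phi> (y - c)) (at x) = frechet_derivative \<phi> (at (x - c))"
proof -
  have "((\<lambda>y. y - c) has_derivative (\<lambda>h. h)) (at x)"
    by (auto intro!: derivative_eq_intros)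
  from has_derivative_compose[OF this has_derivative_test_function[OF assms]]
  have "((\<lambda>y. \<phi> (y - c)) has_derivative frechet_derivative \<phi> (at (x - c))) (at x)" .
  then show ?thesis
    by (rule frechet_derivative_at[symmetric])
qed

section \<open>Integrals of compactly supported continuous functions and their translates\<close>

lemma integrable_compact_support:
  fixes h :: "'a::euclidean_space \<Rightarrow> real"
  assumes "continuous_on UNIV h" and "bounded K" and "\<And>x. x \<notin> K \<Longrightarrow> h x = 0"
  shows "integrable lebesgue h"
proof -
  obtain a b where K: "K \<subseteq> cbox a b"
    using bounded_subset_cbox_symmetric[OF assms(2)] by blast
  have "integrable lborel (\<lambda>x. indicator (cbox a b) x *\<^sub>R h x)"
    using assms(1) by (intro borel_integrable_compact) (auto intro: continuous_on_subset)
  moreover have "(\<lambda>x. indicator (cbox a b) x *\<^sub>R h x) = h"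
    using K assms(3) by (intro ext) (auto simp: indicator_def subset_iff)
  ultimately show ?thesis
    by (simp add: integrable_completion)
qed

text \<open>A bridge to the gauge integral over a box, for which the Leibniz rule for parameter
  integrals is stated.\<close>

lemma lebesgue_integral_eq_cbox:
  fixes h :: "'a::euclidean_space \<Rightarrow> real"
  assumes "continuous_on UNIV h" and "\<And>x. x \<notin> cbox a b \<Longrightarrow> h x = 0"
  shows "integral\<^sup>L lebesgue h = integral (cbox a b) h"
proof -
  have "integral\<^sup>L lebesgue h = integral UNIV h"
    using has_integral_integral_lebesgue[OF integrable_compact_support[OF assms(1) bounded_cbox, of a b]] assms(2)
    by (simp add: integral_unique)
  also have "h = (\<lambda>x. if x \<in> cbox a b then h x else 0)"
    using assms(2) by auto
  then have "integral UNIV h = integral (cbox a b) h"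
    using integral_restrict_UNIV[of "cbox a b" h] by simp
  finally show ?thesis .
qed

lemma lebesgue_integral_translate:
  fixes h :: "'a::euclidean_space \<Rightarrow> real"
  assumes "continuous_on UNIV h"
  shows "integral\<^sup>L lebesgue (\<lambda>y. h (y + a)) = integral\<^sup>L lebesgue h"
proof -
  have h: "h \<in> borel_measurable borel"
    using assms by (rule borel_measurable_continuous_onI)
  have "integral\<^sup>L lborel h = integral\<^sup>L (distr lborel borel ((+) a)) h"
    by (simp add: lborel_distr_plus)
  also have "\<dots> = integral\<^sup>L lborel (\<lambda>y. h (y + a))"
    using h by (subst integral_distr) (auto simp: add.commute)
  moreover have "(\<lambda>y. h (y + a)) \<in> borel_measurable lborel"
    using h by (auto intro: measurable_compose_rev)
  ultimately show ?thesis
    using h by (simp add: integral_completion)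
qed

text \<open>Since the parameter enters through the smooth factor only, differentiation under the
  integral sign asks no more of \<open>f\<close> than continuity.\<close>

lemma integral_translate_has_derivative:
  assumes f: "continuous_on UNIV f" and \<phi>: "test_function S \<phi>"
  shows "((\<lambda>s. integral\<^sup>L lebesgue (\<lambda>y. f y * \<phi> (y - s *\<^sub>R \<tau>))) has_real_derivative
    - integral\<^sup>L lebesgue (\<lambda>y. f y * frechet_derivative \<phi> (at (y - s *\<^sub>R \<tau>)) \<tau>)) (at s)"
proof -
  obtain K where K: "compact K" "\<And>x. x \<notin> K \<Longrightarrow> \<phi> x = 0"
    "\<And>x \<tau>. x \<notin> K \<Longrightarrow> frechet_derivative \<phi> (at x) \<tau> = 0"
    using test_function_support[OF \<phi>] by metis
  \<comment> \<open>The set swept out by \<open>K\<close> under all shifts with parameter within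
    distance 1 of \<open>s\<close>. It is compact, so a single box contains the supports for all
    these parameters.\<close>
  let ?L = "(\<lambda>(k, u). k + u *\<^sub>R \<tau>) ` (K \<times> cball s 1)"
  have "compact ?L"
    unfolding case_prod_unfold using K(1)
    by (intro compact_continuous_image compact_Times continuous_intros compact_cball)
  then obtain a b where ab: "?L \<subseteq> cbox a b"
    using bounded_subset_cbox_symmetric compact_imp_bounded by meson
  have notK: "y - u *\<^sub>R \<tau> \<notin> K" if "y \<notin> cbox a b" "u \<in> ball s 1" for y u
  proof
    assume "y - u *\<^sub>R \<tau> \<in> K"
    then have "(\<lambda>(k, u). k + u *\<^sub>R \<tau>) (y - u *\<^sub>R \<tau>, u) \<in> ?L"
      using that by (intro imageI) auto
    then show False
      using that ab by auto
  qed
  define f' where "f' = (\<lambda>u y. - (f y * frechet_derivative \<phi> (at (y - u *\<^sub>R \<tau>)) \<tau>))"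
  have cont: "continuous_on UNIV (\<lambda>y. f y * \<phi> (y - u *\<^sub>R \<tau>))" for u
    by (intro continuous_intros f continuous_on_compose2[OF continuous_on_test_function[OF \<phi>, of UNIV]]) auto
  have cont': "continuous_on A (\<lambda>(u, y). f' u y)" for A
    unfolding f'_def split_beta
    by (intro continuous_intros continuous_on_compose2[OF f]
        continuous_on_compose2[OF continuous_on_frechet_derivative_test_function[OF \<phi>]]) auto
  have "((\<lambda>u. integral (cbox a b) (\<lambda>y. f y * \<phi> (y - u *\<^sub>R \<tau>))) has_field_derivative
      integral (cbox a b) (f' s)) (at s within ball s 1)"
  proof (rule leibniz_rule_field_derivative)
    fix u y
    have "((\<lambda>u. y - u *\<^sub>R \<tau>) has_derivative (\<lambda>h. - (h *\<^sub>R \<tau>))) (at u)"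
      by (auto intro!: derivative_eq_intros)
    from has_derivative_compose[OF this has_derivative_test_function[OF \<phi>]]
    have "((\<lambda>u. \<phi> (y - u *\<^sub>R \<tau>)) has_derivative (\<lambda>h. frechet_derivative \<phi> (at (y - u *\<^sub>R \<tau>)) (- (h *\<^sub>R \<tau>)))) (at u)" .
    moreover have "frechet_derivative \<phi> (at (y - u *\<^sub>R \<tau>)) (- (h *\<^sub>R \<tau>)) = (- frechet_derivative \<phi> (at (y - u *\<^sub>R \<tau>)) \<tau>) * h" for h
      using has_derivative_linear[OF has_derivative_test_function[OF \<phi>]]
      by (simp add: linear_neg linear_scale mult.commute)
    ultimately have "((\<lambda>u. \<phi> (y - u *\<^sub>R \<tau>)) has_real_derivative - frechet_derivative \<phi> (at (y - u *\<^sub>R \<tau>)) \<tau>) (at u)"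
      unfolding has_field_derivative_def by (simp only:)
    from DERIV_cmult[OF this, of "f y"]
    show "((\<lambda>u. f y * \<phi> (y - u *\<^sub>R \<tau>)) has_field_derivative f' u y) (at u within ball s 1)"
      by (auto simp: f'_def intro: has_field_derivative_at_within)
  qed (auto intro!: integrable_continuous continuous_on_subset[OF cont] cont')
  then have d: "((\<lambda>u. integral (cbox a b) (\<lambda>y. f y * \<phi> (y - u *\<^sub>R \<tau>))) has_field_derivative
      integral (cbox a b) (f' s)) (at s)"
    using at_within_open[of s "ball s 1"] by simp
  have "integral (cbox a b) (f' s) = integral\<^sup>L lebesgue (f' s)"
  proof (rule lebesgue_integral_eq_cbox[symmetric])
    show "continuous_on UNIV (f' s)"
      unfolding f'_def
      by (intro continuous_intros f
          continuous_on_compose2[OF continuous_on_frechet_derivative_test_function[OF \<phi>]]) auto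
    show "f' s y = 0" if "y \<notin> cbox a b" for y
      using notK[OF that, of s] K(3) by (simp add: f'_def)
  qed
  also have "\<dots> = - integral\<^sup>L lebesgue (\<lambda>y. f y * frechet_derivative \<phi> (at (y - s *\<^sub>R \<tau>)) \<tau>)"
    by (simp add: f'_def)
  finally have d': "integral (cbox a b) (f' s) = \<dots>" .
  have eq: "integral (cbox a b) (\<lambda>y. f y * \<phi> (y - u *\<^sub>R \<tau>)) = integral\<^sup>L lebesgue (\<lambda>y. f y * \<phi> (y - u *\<^sub>R \<tau>))"
    if "u \<in> ball s 1" for u
    using notK[OF _ that] K(2) by (intro lebesgue_integral_eq_cbox[symmetric] cont) auto
  show ?thesis
    by (rule has_field_derivative_transform_within_open[OF d[unfolded d'] open_ball _ eq]) auto
qed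

text \<open>A global form of weak differentiability in \<open>\<Omega>\<close>: \<open>f\<close>
  lives on the whole plane, \<open>D\<close> is extended by zero and is bounded everywhere, not just
  almost everywhere. All integrals are then over the plane, where translation invariance is
  available.\<close>

definition has_weak_derivative :: "plane set \<Rightarrow> (plane \<Rightarrow> real) \<Rightarrow> (plane \<Rightarrow> plane) \<Rightarrow> bool" where
  "has_weak_derivative \<Omega> f D \<longleftrightarrow>
     continuous_on UNIV f \<and> D \<in> borel_measurable lebesgue \<and> bounded (range D) \<and> (\<forall>x. x \<notin> \<Omega> \<longrightarrow> D x = 0) \<and>
     (\<forall>\<phi> \<tau>. test_function \<Omega> \<phi> \<longrightarrow>
       integral\<^sup>L lebesgue (\<lambda>x. f x * frechet_derivative \<phi> (at x) \<tau>) =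
       - integral\<^sup>L lebesgue (\<lambda>x. (D x \<bullet> \<tau>) * \<phi> x))"

text \<open>Integration by parts is applied to the translate, so it is the translate that has to be
  a test function of \<open>\<Omega>\<close>.\<close>

lemma integral_translate_weak_derivative:
  assumes "has_weak_derivative \<Omega> f D" and \<phi>: "test_function S \<phi>"
    and "test_function \<Omega> (\<lambda>y. \<phi> (y - s *\<^sub>R \<tau>))"
  shows "((\<lambda>s. integral\<^sup>L lebesgue (\<lambda>y. f y * \<phi> (y - s *\<^sub>R \<tau>))) has_real_derivative
    integral\<^sup>L lebesgue (\<lambda>y. (D y \<bullet> \<tau>) * \<phi> (y - s *\<^sub>R \<tau>))) (at s)"
proof -
  have "continuous_on UNIV f"
    using assms(1) by (simp add: has_weak_derivative_def)
  from integral_translate_has_derivative[OF this \<phi>, of \<tau> s] assms(1,3)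
  show ?thesis
    unfolding has_weak_derivative_def frechet_derivative_translate[OF \<phi>, symmetric] by simp
qed

section \<open>Local averages with bumps\<close>

lemma integrable_bump: "r > 0 \<Longrightarrow> integrable lebesgue (bump c r)"
  by (rule integrable_compact_support[of _ "cball c r"])
    (use C_k_bump[of 0] bump_eq_0[of r _ c] ball_subset_cball[of c r] in auto)

lemma integral_bump_eq: "integral\<^sup>L lebesgue (bump c r) = integral\<^sup>L lebesgue (bump 0 r)"
  using lebesgue_integral_translate[of "bump 0 r" "- c"] C_k_bump[of 0 0 r]
  by (simp add: bump_translate)

lemma integral_bump_pos:
  assumes "r > 0"
  shows "0 < integral\<^sup>L lebesgue (bump c r)"
proof (rule ccontr)
  assume "\<not> ?thesis"
  then have "integral\<^sup>L lebesgue (bump c r) = 0"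
    using Bochner_Integration.integral_nonneg[of lebesgue "bump c r", OF bump_nonneg] by linarith
  then have "AE x in lebesgue. bump c r x = 0"
    using integral_nonneg_eq_0_iff_AE[OF integrable_bump[OF assms]] bump_nonneg by blast
  then have "AE x in lebesgue. x \<notin> ball c r"
    by (rule AE_mp, intro AE_I2) (use bump_pos_iff[of r c] assms in \<open>simp, metis less_irrefl\<close>)
  then have "negligible (ball c r)"
    by (simp add: negligible_iff_null_sets AE_iff_null_sets)
  then show False
    using open_not_negligible[of "ball c r"] assms by auto
qed

text \<open>A weighted average of \<open>f\<close> is within \<open>\<epsilon>\<close> of the value
  at the centre. The mass of the bump stands on both sides because it does not depend on the centre
  and can be divided out after two such averages are compared.\<close>

lemma integral_bump_approx:
  assumes "continuous_on UNIV f" and "r > 0" and "\<And>y. y \<in> ball c r \<Longrightarrow> \<bar>f y - f c\<bar> \<le> \<epsilon>"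
  shows "\<bar>integral\<^sup>L lebesgue (\<lambda>y. f y * bump c r y) - f c * integral\<^sup>L lebesgue (bump 0 r)\<bar>
    \<le> \<epsilon> * integral\<^sup>L lebesgue (bump 0 r)"
proof -
  have cb: "continuous_on UNIV (bump c r)"
    using C_k_bump[of 0 c r] by simp
  have zero: "bump c r x = 0" if "x \<notin> cball c r" for x
    using that bump_eq_0[of r x c] assms(2) by auto
  have i: "integrable lebesgue (\<lambda>y. f y * bump c r y)"
    by (rule integrable_compact_support[of _ "cball c r"])
      (auto intro!: continuous_intros assms(1) cb simp: zero)
  have "integral\<^sup>L lebesgue (\<lambda>y. f y * bump c r y) - f c * integral\<^sup>L lebesgue (bump 0 r)
      = integral\<^sup>L lebesgue (\<lambda>y. (f y - f c) * bump c r y)"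
    using i integrable_bump[OF assms(2), of c]
    by (simp add: left_diff_distrib integral_bump_eq[of c])
  also have "\<bar>\<dots>\<bar> \<le> integral\<^sup>L lebesgue (\<lambda>y. \<bar>(f y - f c) * bump c r y\<bar>)"
    by (rule integral_abs_bound)
  also have "\<dots> \<le> integral\<^sup>L lebesgue (\<lambda>y. \<epsilon> * bump c r y)"
  proof (rule integral_mono)
    show "integrable lebesgue (\<lambda>y. \<bar>(f y - f c) * bump c r y\<bar>)"
      using i integrable_bump[OF assms(2), of c]
      by (intro integrable_abs) (simp add: left_diff_distrib)
    show "\<bar>(f y - f c) * bump c r y\<bar> \<le> \<epsilon> * bump c r y" for y
      using assms(3)[of y] bump_eq_0[of r y c] assms(2) bump_nonneg[of c r y]
      by (cases "y \<in> ball c r") (auto simp: abs_mult intro: mult_right_mono)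
  qed (use integrable_bump[OF assms(2)] in auto)
  finally show ?thesis
    by (simp add: integral_bump_eq[of c])
qed

text \<open>Testing with a bump moved along the segment makes the local average of $f$ differentiable in the
  position of the bump, with derivative at most $S$ times the mass of the bump; the mean value theorem applies.\<close>

lemma weak_derivative_segment_bound:
  assumes wd: "has_weak_derivative \<Omega> f D" and U: "open U" "U \<subseteq> \<Omega>" "closed_segment x (x + \<tau>) \<subseteq> U"
    and S: "AE y in lebesgue. y \<in> U \<longrightarrow> \<bar>D y \<bullet> \<tau>\<bar> \<le> S"
  shows "\<bar>f (x + \<tau>) - f x\<bar> \<le> S"
proof (rule field_le_epsilon)
  fix e :: real assume "e > 0"
  \<comment> \<open>Replacing the values of \<open>f\<close> at the two ends by averages costs
    \<open>\<epsilon>\<close> each.\<close>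
  define \<epsilon> where "\<epsilon> = e / 2"
  have "\<epsilon> > 0" using \<open>e > 0\<close> by (simp add: \<epsilon>_def)
  have f: "continuous_on UNIV f" and D: "D \<in> borel_measurable lebesgue"
    using wd by (auto simp: has_weak_derivative_def)
  obtain \<rho> where \<rho>: "\<rho> > 0" "(\<Union>z\<in>closed_segment x (x + \<tau>). cball z \<rho>) \<subseteq> U"
    using compact_subset_open_imp_cball_epsilon_subset[OF compact_segment U(1,3)] by blast
  obtain d where d: "d > 0" "\<And>y. dist y x < d \<Longrightarrow> \<bar>f y - f x\<bar> < \<epsilon>"
    using f \<open>\<epsilon> > 0\<close> unfolding continuous_on_iff dist_real_def by (metis UNIV_I)
  obtain d' where d': "d' > 0" "\<And>y. dist y (x + \<tau>) < d' \<Longrightarrow> \<bar>f y - f (x + \<tau>)\<bar> < \<epsilon>"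
    using f \<open>\<epsilon> > 0\<close> unfolding continuous_on_iff dist_real_def by (metis UNIV_I)
  define r where "r = min \<rho> (min d d')"
  have r: "r > 0" "r \<le> \<rho>" "r \<le> d" "r \<le> d'"
    using \<rho> d d' by (auto simp: r_def)
  let ?I = "integral\<^sup>L lebesgue (bump 0 r)"
  define F where "F = (\<lambda>s. integral\<^sup>L lebesgue (\<lambda>y. f y * bump x r (y - s *\<^sub>R \<tau>)))"
  define F' where "F' = (\<lambda>s. integral\<^sup>L lebesgue (\<lambda>y. (D y \<bullet> \<tau>) * bump (x + s *\<^sub>R \<tau>) r y))"
  have sub: "cball (x + s *\<^sub>R \<tau>) r \<subseteq> U" if "0 \<le> s" "s \<le> 1" for s
  proof -
    have "x + s *\<^sub>R \<tau> \<in> closed_segment x (x + \<tau>)"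
      unfolding closed_segment_def using that by (auto intro!: exI[of _ s] simp: algebra_simps)
    then show ?thesis
      using \<rho>(2) r(2) by (force simp: subset_iff)
  qed
  have test: "test_function \<Omega> (bump (x + s *\<^sub>R \<tau>) r)" if "0 \<le> s" "s \<le> 1" for s
    using sub[OF that] U(2) r(1) by (intro test_function_bump) auto
  have "(F has_real_derivative F' s) (at s)" if "0 \<le> s" "s \<le> 1" for s
    unfolding F_def F'_def using that test[of 0] test[OF that]
    integral_translate_weak_derivative[OF wd, of \<Omega> "bump x r" s \<tau>]
    by (simp add: bump_translate)
  from MVT2[of 0 1 F F'] this
  obtain s where s: "0 < s" "s < 1" "F 1 - F 0 = F' s" by auto
  have b: "bump (x + s *\<^sub>R \<tau>) r y = 0" if "y \<notin> U" for y
    using sub[of s] s that bump_eq_0[of r y "x + s *\<^sub>R \<tau>"] r(1) ball_subset_cball by fastforce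
  have "\<bar>F' s\<bar> \<le> integral\<^sup>L lebesgue (\<lambda>y. \<bar>(D y \<bullet> \<tau>) * bump (x + s *\<^sub>R \<tau>) r y\<bar>)"
    unfolding F'_def by (rule integral_abs_bound)
  also have "\<dots> \<le> integral\<^sup>L lebesgue (\<lambda>y. S * bump (x + s *\<^sub>R \<tau>) r y)"
  proof (rule integral_mono_AE)
    show le: "AE y in lebesgue. \<bar>(D y \<bullet> \<tau>) * bump (x + s *\<^sub>R \<tau>) r y\<bar> \<le> S * bump (x + s *\<^sub>R \<tau>) r y"
      using S
    proof (rule AE_mp, intro AE_I2 impI)
      fix y assume "y \<in> U \<longrightarrow> \<bar>D y \<bullet> \<tau>\<bar> \<le> S"
      then show "\<bar>(D y \<bullet> \<tau>) * bump (x + s *\<^sub>R \<tau>) r y\<bar> \<le> S * bump (x + s *\<^sub>R \<tau>) r y"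
        using b[of y] bump_nonneg[of "x + s *\<^sub>R \<tau>" r y]
        by (cases "y \<in> U") (auto simp: abs_mult intro: mult_right_mono)
    qed
    show i: "integrable lebesgue (\<lambda>y. S * bump (x + s *\<^sub>R \<tau>) r y)"
      using integrable_bump[OF r(1)] by simp
    have "(\<lambda>y. (D y \<bullet> \<tau>) * bump (x + s *\<^sub>R \<tau>) r y) \<in> borel_measurable lebesgue"
      using D integrable_bump[OF r(1), of "x + s *\<^sub>R \<tau>"] by (intro borel_measurable_times borel_measurable_inner) auto
    then show "integrable lebesgue (\<lambda>y. \<bar>(D y \<bullet> \<tau>) * bump (x + s *\<^sub>R \<tau>) r y\<bar>)"
      using le by (intro integrable_abs Bochner_Integration.integrable_bound[OF i]) auto
  qed
  also have "\<dots> = S * ?I"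
    by (simp add: integral_bump_eq[of "x + s *\<^sub>R \<tau>"])
  finally have 1: "\<bar>F 1 - F 0\<bar> \<le> S * ?I"
    using s by simp
  have "\<bar>f y - f x\<bar> \<le> \<epsilon>" if "y \<in> ball x r" for y
    using that d(2)[of y] r(3) by (simp add: dist_commute)
  then have 2: "\<bar>F 0 - f x * ?I\<bar> \<le> \<epsilon> * ?I"
    using integral_bump_approx[OF f r(1), of x \<epsilon>] by (simp add: F_def)
  have "\<bar>f y - f (x + \<tau>)\<bar> \<le> \<epsilon>" if "y \<in> ball (x + \<tau>) r" for y
    using that d'(2)[of y] r(4) by (simp add: dist_commute)
  then have 3: "\<bar>F 1 - f (x + \<tau>) * ?I\<bar> \<le> \<epsilon> * ?I"
    using integral_bump_approx[OF f r(1), of "x + \<tau>" \<epsilon>] by (simp add: F_def bump_translate)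
  have "\<bar>f (x + \<tau>) - f x\<bar> * ?I = \<bar>f (x + \<tau>) * ?I - f x * ?I\<bar>"
    using integral_bump_pos[OF r(1), of 0] by (simp add: abs_mult flip: left_diff_distrib)
  also have "\<dots> \<le> S * ?I + \<epsilon> * ?I + \<epsilon> * ?I"
    using 1 2 3 by linarith
  also have "\<dots> = (S + e) * ?I"
    by (simp add: \<epsilon>_def algebra_simps)
  finally show "\<bar>f (x + \<tau>) - f x\<bar> \<le> S + e"
    using integral_bump_pos[OF r(1), of 0] by simp
qed

subsection \<open>Density of test functions\<close>

text \<open>A sum $\psi$ of bumps is positive on $K$ and supported in $\Omega$. Dividing by $\psi$, approximating the
  quotient by polynomials $p_n$ and multiplying back yields the test functions $\psi p_n$.\<close>

lemma test_function_dense_compact: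
  fixes g :: "plane \<Rightarrow> real"
  assumes \<Omega>: "open \<Omega>" "bounded \<Omega>" and g: "g \<in> borel_measurable lebesgue" "\<And>x. \<bar>g x\<bar> \<le> C"
    and K: "compact K" "K \<subseteq> \<Omega>" and "e > 0"
  obtains \<phi> where "test_function \<Omega> \<phi>" "integral\<^sup>L lebesgue (\<lambda>x. \<bar>indicator K x * g x - \<phi> x\<bar>) < e"
proof -
  have "\<exists>r. \<forall>x\<in>K. r x > 0 \<and> cball x (r x) \<subseteq> \<Omega>"
    using K(2) \<Omega>(1) by (intro bchoice) (meson open_contains_cball subsetD)
  then obtain r where r: "\<And>x. x \<in> K \<Longrightarrow> r x > 0" "\<And>x. x \<in> K \<Longrightarrow> cball x (r x) \<subseteq> \<Omega>"
    by metis
  obtain I where I: "I \<subseteq> K" "finite I" "K \<subseteq> (\<Union>i\<in>I. ball i (r i))"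
  proof (rule compactE_image[OF K(1), of K "\<lambda>i. ball i (r i)"])
    show "K \<subseteq> (\<Union>i\<in>K. ball i (r i))" using r(1) by force
  qed auto
  define \<psi> where "\<psi> = (\<lambda>x. \<Sum>i\<in>I. bump i (r i) x)"
  have r': "r i > 0" "cball i (r i) \<subseteq> \<Omega>" if "i \<in> I" for i
    using r I(1) that by auto
  have test: "test_function \<Omega> (\<lambda>x. \<psi> x * p x)" if "real_polynomial_function p" for p
    unfolding \<psi>_def
    by (rule test_function_sum_bump[where c = "\<lambda>i. i" and r = r])
      (use I(2) r' C_k_real_polynomial_function[OF that] in \<open>auto intro: less_imp_le\<close>)
  have \<psi>_nonneg: "\<psi> x \<ge> 0" for x
    unfolding \<psi>_def by (intro sum_nonneg bump_nonneg)
  have \<psi>_pos: "\<psi> x > 0" if x: "x \<in> K" for x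
  proof -
    obtain i where "i \<in> I" "x \<in> ball i (r i)" using subsetD[OF I(3) x] by (rule UN_E)
    then show ?thesis
      unfolding \<psi>_def using bump_pos_iff[of "r i" i x] r'(1)[of i] I(2)
      by (intro sum_pos2[of I i]) (auto simp: bump_nonneg)
  qed
  have "test_function \<Omega> (\<lambda>x. \<psi> x * 1)"
    by (rule test) (rule real_polynomial_function.intros)
  then have test1: "test_function \<Omega> \<psi>" by simp
  have \<psi>_cont: "continuous_on UNIV \<psi>"
    using continuous_on_test_function[OF test1] .
  \<comment> \<open>A positive lower bound of \<open>\<psi>\<close> on \<open>K\<close> keeps the
    quotient by \<open>\<psi>\<close> bounded. For empty \<open>K\<close> any positive number
    serves.\<close>
  obtain m where m: "m > 0" "\<And>x. x \<in> K \<Longrightarrow> \<psi> x \<ge> m"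
  proof (cases "K = {}")
    case True
    then show ?thesis using that[of 1] by auto
  next
    case False
    then obtain z where "z \<in> K" "\<forall>x\<in>K. \<psi> z \<le> \<psi> x"
      using continuous_attains_inf[OF K(1) _ continuous_on_subset[OF \<psi>_cont]] by auto
    then show ?thesis using that[of "\<psi> z"] \<psi>_pos by auto
  qed
  define B where "B = C / m"
  have "C \<ge> 0" using g(2)[of 0] by linarith
  then have "B \<ge> 0" using m by (simp add: B_def)
  define h where "h = (\<lambda>x. indicator K x * g x / \<psi> x)"
  have h_bound: "\<bar>h x\<bar> \<le> B" for x
  proof (cases "x \<in> K")
    case True
    then have "\<bar>g x\<bar> / \<psi> x \<le> C / m"
      using m(1) m(2)[OF True] g(2)[of x] by (intro frac_le) auto
    then show ?thesis using True \<psi>_pos[OF True] by (simp add: h_def B_def)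
  qed (use \<open>B \<ge> 0\<close> in \<open>simp add: h_def\<close>)
  have h_mult: "\<psi> x * h x = indicator K x * g x" for x
    using \<psi>_pos[of x] by (cases "x \<in> K") (auto simp: h_def)
  have Kmeas: "K \<in> sets lebesgue"
    using K(1) by (simp add: borel_compact)
  have "\<psi> \<in> borel_measurable lebesgue"
    using borel_measurable_continuous_onI[OF \<psi>_cont] by (simp add: measurable_completion)
  then have "h \<in> borel_measurable lebesgue"
    unfolding h_def using g(1) Kmeas by (intro borel_measurable_divide borel_measurable_times) auto
  then have "h measurable_on UNIV"
    by (intro lebesgue_measurable_imp_measurable_on) auto
  then obtain N c where N: "negligible N" and c: "\<And>n. continuous_on UNIV (c n)"
    "\<And>x. x \<notin> N \<Longrightarrow> (\<lambda>n. c n x) \<longlonglongrightarrow> h x"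
    unfolding measurable_on_def by auto
  obtain a b where ab: "\<Omega> \<subseteq> cbox a b"
    using bounded_subset_cbox_symmetric[OF \<Omega>(2)] by blast
  \<comment> \<open>The continuous functions \<open>c n\<close> converge to \<open>h\<close> almost
    everywhere but need not be bounded uniformly. Cutting them off at the bound \<open>B\<close> of
    \<open>h\<close> preserves the limit and provides the dominating function below.\<close>
  define c' where "c' = (\<lambda>n x. max (- B) (min B (c n x)))"
  have "\<exists>p. real_polynomial_function p \<and> (\<forall>x\<in>cbox a b. \<bar>c' n x - p x\<bar> < inverse (real (Suc n)))" for n
  proof -
    have "continuous_on (cbox a b) (c' n)"
      unfolding c'_def by (intro continuous_intros continuous_on_subset[OF c(1)]) auto
    from Stone_Weierstrass_real_polynomial_function[OF compact_cbox this, of "inverse (real (Suc n))"]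
    show ?thesis by (metis inverse_positive_iff_positive of_nat_0_less_iff zero_less_Suc)
  qed
  then obtain p where p: "\<And>n. real_polynomial_function (p n)"
    "\<And>n x. x \<in> cbox a b \<Longrightarrow> \<bar>c' n x - p n x\<bar> < inverse (real (Suc n))"
    by metis
  obtain S where S: "S \<subseteq> \<Omega>" "compact S" "\<And>x. x \<notin> S \<Longrightarrow> \<psi> x = 0"
    using test_function_support[OF test1] by metis
  have lim: "(\<lambda>n. \<psi> x * p n x) \<longlonglongrightarrow> indicator K x * g x" if "x \<notin> N" for x
  proof (cases "x \<in> cbox a b")
    case True
    have "(\<lambda>n. c' n x) \<longlonglongrightarrow> max (- B) (min B (h x))"
      unfolding c'_def by (intro tendsto_intros c(2) that)
    also have "max (- B) (min B (h x)) = h x"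
      using h_bound[of x] by auto
    finally have "(\<lambda>n. c' n x) \<longlonglongrightarrow> h x" .
    moreover have "(\<lambda>n. p n x - c' n x) \<longlonglongrightarrow> 0"
      by (rule Lim_null_comparison[OF _ LIMSEQ_inverse_real_of_nat])
        (use p(2)[OF True] in \<open>auto simp: abs_minus_commute intro!: always_eventually less_imp_le\<close>)
    ultimately have "(\<lambda>n. c' n x + (p n x - c' n x)) \<longlonglongrightarrow> h x + 0"
      by (rule tendsto_add)
    then have "(\<lambda>n. \<psi> x * p n x) \<longlonglongrightarrow> \<psi> x * h x"
      by (intro tendsto_mult_left) simp
    then show ?thesis by (simp add: h_mult)
  next
    case False
    then have "\<psi> x = 0" using S ab by blast
    then show ?thesis unfolding h_mult[symmetric] by simp
  qed
  have bound: "\<bar>\<psi> x * p n x\<bar> \<le> (B + 1) * \<psi> x" for n x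
  proof (cases "x \<in> cbox a b")
    case True
    have "inverse (real (Suc n)) \<le> 1" by (simp add: field_simps)
    moreover have "\<bar>c' n x\<bar> \<le> B" using \<open>B \<ge> 0\<close> by (auto simp: c'_def)
    ultimately have "\<bar>p n x\<bar> \<le> B + 1" using p(2)[OF True, of n] by linarith
    then show ?thesis
      using \<psi>_nonneg[of x] by (simp add: abs_mult mult.commute mult_left_mono)
  next
    case False
    then have "\<psi> x = 0" using S ab by blast
    then show ?thesis by simp
  qed
  have \<psi>_int: "integrable lebesgue \<psi>"
    using S by (intro integrable_compact_support[OF \<psi>_cont compact_imp_bounded]) auto
  have K_int: "integrable lebesgue (indicat_real K)"
    using lmeasurable_compact[OF K(1)] by (simp add: lmeasurable_iff_integrable)
  have Kg: "(\<lambda>x. indicator K x * g x) \<in> borel_measurable lebesgue"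
    using Kmeas g(1) by (intro borel_measurable_times) auto
  have "(\<lambda>n. integral\<^sup>L lebesgue (\<lambda>x. \<bar>indicator K x * g x - \<psi> x * p n x\<bar>)) \<longlonglongrightarrow> integral\<^sup>L lebesgue (\<lambda>x::plane. 0)"
  proof (rule integral_dominated_convergence[where w = "\<lambda>x. C * indicator K x + (B + 1) * \<psi> x"])
    show "(\<lambda>x. \<bar>indicator K x * g x - \<psi> x * p n x\<bar>) \<in> borel_measurable lebesgue" for n
      using borel_measurable_continuous_onI[OF continuous_on_test_function[OF test[OF p(1)[of n]]]] Kg
      by (intro borel_measurable_abs borel_measurable_diff) (auto simp: measurable_completion)
    show "integrable lebesgue (\<lambda>x. C * indicator K x + (B + 1) * \<psi> x)"
      using \<psi>_int K_int by auto
    have "AE x in lebesgue. x \<notin> N"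
      using N by (simp add: negligible_iff_null_sets AE_not_in)
    then show "AE x in lebesgue. (\<lambda>n. \<bar>indicator K x * g x - \<psi> x * p n x\<bar>) \<longlonglongrightarrow> 0"
    proof (rule AE_mp, intro AE_I2 impI)
      fix x assume "x \<notin> N"
      from tendsto_rabs[OF tendsto_diff[OF tendsto_const[of "indicator K x * g x"] lim[OF this]]]
      show "(\<lambda>n. \<bar>indicator K x * g x - \<psi> x * p n x\<bar>) \<longlonglongrightarrow> 0" by simp
    qed
    show "AE x in lebesgue. norm \<bar>indicator K x * g x - \<psi> x * p n x\<bar> \<le> C * indicator K x + (B + 1) * \<psi> x" for n
    proof (intro AE_I2)
      fix x
      have "\<bar>indicator K x * g x\<bar> \<le> C * indicator K x"
        using g(2)[of x] by (simp add: indicator_def)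
      then show "norm \<bar>indicator K x * g x - \<psi> x * p n x\<bar> \<le> C * indicator K x + (B + 1) * \<psi> x"
        using bound[of x n] by simp
    qed
  qed simp
  then have "\<forall>\<^sub>F n in sequentially. integral\<^sup>L lebesgue (\<lambda>x. \<bar>indicator K x * g x - \<psi> x * p n x\<bar>) < e"
    using \<open>e > 0\<close> by (intro order_tendstoD) auto
  then obtain n where "integral\<^sup>L lebesgue (\<lambda>x. \<bar>indicator K x * g x - \<psi> x * p n x\<bar>) < e"
    by (auto simp: eventually_sequentially)
  then show ?thesis
    using that test[OF p(1)] by blast
qed

lemma integrable_bounded_indicator:
  fixes g :: "plane \<Rightarrow> real"
  assumes "S \<in> lmeasurable" and "g \<in> borel_measurable lebesgue" "\<And>x. \<bar>g x\<bar> \<le> C"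
  shows "integrable lebesgue (\<lambda>x. indicator S x * g x)"
proof (rule Bochner_Integration.integrable_bound)
  show "integrable lebesgue (\<lambda>x. C * indicator S x)"
    using assms(1) by (intro integrable_mult_right) (simp add: lmeasurable_iff_integrable)
  show "(\<lambda>x. indicator S x * g x) \<in> borel_measurable lebesgue"
    using assms by (intro borel_measurable_times) auto
  show "AE x in lebesgue. norm (indicator S x * g x) \<le> norm (C * indicator S x)"
    using assms(3) by (intro AE_I2) (auto simp: indicator_def intro: order_trans[OF _ abs_ge_self])
qed

lemma integrable_test_function:
  assumes "test_function S \<phi>"
  shows "integrable lebesgue \<phi>"
proof -
  obtain K where "compact K" "\<And>x. x \<notin> K \<Longrightarrow> \<phi> x = 0"
    using test_function_support[OF assms] by metis
  then show ?thesis
    by (intro integrable_compact_support[OF continuous_on_test_function[OF assms] compact_imp_bounded])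
qed

text \<open>An exhaustion of \<open>\<Omega>\<close> by compact sets loses arbitrarily little of the
  integral, by dominated convergence; on one of these sets
  \<open>test_function_dense_compact\<close> applies. Half of \<open>e\<close> is reserved for each
  of the two errors.\<close>

lemma test_function_dense:
  fixes g :: "plane \<Rightarrow> real"
  assumes \<Omega>: "open \<Omega>" "bounded \<Omega>" and g: "g \<in> borel_measurable lebesgue" "\<And>x. \<bar>g x\<bar> \<le> C" and "e > 0"
  obtains \<phi> where "test_function \<Omega> \<phi>" "integral\<^sup>L lebesgue (\<lambda>x. \<bar>indicator \<Omega> x * g x - \<phi> x\<bar>) < e"
proof -
  obtain K where K: "\<And>n. compact (K n)" "\<And>n. K n \<subseteq> \<Omega>"
    "\<And>n. K n \<subseteq> interior (K (Suc n))" "\<Union>(range K) = \<Omega>"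
    "\<And>L. compact L \<Longrightarrow> L \<subseteq> \<Omega> \<Longrightarrow> \<exists>N. \<forall>n\<ge>N. L \<subseteq> K n"
    by (rule open_Union_compact_subsets[OF \<Omega>(1)], rule that) auto
  have \<Omega>m: "\<Omega> \<in> lmeasurable"
    using \<Omega> by (simp add: lmeasurable_open)
  have Km: "K n \<in> lmeasurable" for n
    using K(1) by (rule lmeasurable_compact)
  have iK: "integrable lebesgue (\<lambda>x. indicator (K n) x * g x)" for n
    by (rule integrable_bounded_indicator[OF Km g])
  have i\<Omega>: "integrable lebesgue (\<lambda>x. indicator \<Omega> x * g x)"
    by (rule integrable_bounded_indicator[OF \<Omega>m g])
  have "(\<lambda>n. integral\<^sup>L lebesgue (\<lambda>x. \<bar>indicator \<Omega> x * g x - indicator (K n) x * g x\<bar>)) \<longlonglongrightarrow> integral\<^sup>L lebesgue (\<lambda>x::plane. 0)"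
  proof (rule integral_dominated_convergence[where w = "\<lambda>x. \<bar>indicator \<Omega> x * g x\<bar>"])
    show "AE x in lebesgue. (\<lambda>n. \<bar>indicator \<Omega> x * g x - indicator (K n) x * g x\<bar>) \<longlonglongrightarrow> 0"
    proof (intro AE_I2 tendsto_eventually)
      fix x
      show "\<forall>\<^sub>F n in sequentially. \<bar>indicator \<Omega> x * g x - indicator (K n) x * g x\<bar> = 0"
      proof (cases "x \<in> \<Omega>")
        case True
        then obtain N where "\<forall>n\<ge>N. {x} \<subseteq> K n"
          using K(5)[of "{x}"] by auto
        then show ?thesis
          using True unfolding eventually_sequentially by (intro exI[of _ N]) simp
      next
        case False
        then have "x \<notin> K n" for n using K(2)[of n] by blast
        with False show ?thesis by simp
      qed
    qed
    show "AE x in lebesgue. norm \<bar>indicator \<Omega> x * g x - indicator (K n) x * g x\<bar> \<le> \<bar>indicator \<Omega> x * g x\<bar>" for n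
      using K(2)[of n] by (intro AE_I2) (auto simp: indicator_def)
  qed (use i\<Omega> iK in auto)
  then have "\<forall>\<^sub>F n in sequentially. integral\<^sup>L lebesgue (\<lambda>x. \<bar>indicator \<Omega> x * g x - indicator (K n) x * g x\<bar>) < e / 2"
    using \<open>e > 0\<close> by (intro order_tendstoD) auto
  then obtain n where n: "integral\<^sup>L lebesgue (\<lambda>x. \<bar>indicator \<Omega> x * g x - indicator (K n) x * g x\<bar>) < e / 2"
    by (auto simp: eventually_sequentially)
  obtain \<phi> where \<phi>: "test_function \<Omega> \<phi>"
    "integral\<^sup>L lebesgue (\<lambda>x. \<bar>indicator (K n) x * g x - \<phi> x\<bar>) < e / 2"
    using test_function_dense_compact[OF \<Omega> g K(1,2)[of n], of "e / 2"] \<open>e > 0\<close> by auto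
  have i\<phi>: "integrable lebesgue \<phi>"
    by (rule integrable_test_function[OF \<phi>(1)])
  have "integral\<^sup>L lebesgue (\<lambda>x. \<bar>indicator \<Omega> x * g x - \<phi> x\<bar>)
      \<le> integral\<^sup>L lebesgue (\<lambda>x. \<bar>indicator \<Omega> x * g x - indicator (K n) x * g x\<bar> + \<bar>indicator (K n) x * g x - \<phi> x\<bar>)"
    using i\<Omega> iK[of n] i\<phi> by (intro integral_mono) auto
  also have "\<dots> < e"
    using i\<Omega> iK[of n] i\<phi> n \<phi>(2) by simp
  finally show ?thesis
    using that \<phi>(1) by blast
qed

subsection \<open>Weak limits of difference quotients\<close>

text \<open>The step sizes 1/(n+1) form a sequence, as dominated convergence requires, and none of
  them is zero.\<close>

definition diff_quotient :: "(plane \<Rightarrow> real) \<Rightarrow> plane \<Rightarrow> nat \<Rightarrow> plane \<Rightarrow> real" where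
  "diff_quotient f \<tau> n y = (f (y + inverse (real (Suc n)) *\<^sub>R \<tau>) - f y) * real (Suc n)"

text \<open>Abstracts the components of u - F x, extended by zero. The null frontier belongs here
  because the behaviour of difference quotients is controlled inside \<open>\<Omega>\<close> and
  away from its closure, but not on the frontier.\<close>

locale lipschitz_zero_trace =
  fixes \<Omega> :: "plane set" and f :: "plane \<Rightarrow> real" and D :: "plane \<Rightarrow> plane" and L :: real
  assumes weak_derivative: "has_weak_derivative \<Omega> f D"
    and open_domain: "open \<Omega>" and bounded_domain: "bounded \<Omega>"
    and negligible_frontier: "negligible (frontier \<Omega>)"
    and zero_outside: "x \<notin> \<Omega> \<Longrightarrow> f x = 0"
    and lipschitz: "\<bar>f x - f y\<bar> \<le> L * norm (x - y)"
begin

lemma continuous: "continuous_on UNIV f"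
  using weak_derivative by (simp add: has_weak_derivative_def)

lemma diff_quotient_bound: "\<bar>diff_quotient f \<tau> n y\<bar> \<le> L * norm \<tau>"
proof -
  have "\<bar>diff_quotient f \<tau> n y\<bar> \<le> L * norm (inverse (real (Suc n)) *\<^sub>R \<tau>) * real (Suc n)"
    unfolding diff_quotient_def abs_mult
    using lipschitz[of "y + inverse (real (Suc n)) *\<^sub>R \<tau>" y] by (intro mult_mono) auto
  also have "\<dots> = L * norm \<tau>"
    by (simp del: of_nat_Suc)
  finally show ?thesis .
qed

lemma continuous_diff_quotient: "continuous_on UNIV (diff_quotient f \<tau> n)"
  unfolding diff_quotient_def
  by (intro continuous_intros continuous continuous_on_compose2[OF continuous]) auto

text \<open>No step exceeds 1, so enlarging a ball around \<open>\<Omega>\<close> by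
  \<open>norm \<tau>\<close> gives one compact set for all \<open>n\<close>.\<close>

lemma diff_quotient_support:
  obtains K where "compact K" "\<And>n y. y \<notin> K \<Longrightarrow> diff_quotient f \<tau> n y = 0"
proof -
  obtain r where r: "\<Omega> \<subseteq> cball 0 r"
    using bounded_domain by (force simp: bounded_iff subset_iff)
  have "diff_quotient f \<tau> n y = 0" if y: "y \<notin> cball 0 (r + norm \<tau>)" for n y
  proof -
    have "norm (inverse (real (Suc n)) *\<^sub>R \<tau>) \<le> norm \<tau>"
      by (simp add: field_simps mult_le_cancel_left1)
    moreover have "norm y \<le> norm (y + inverse (real (Suc n)) *\<^sub>R \<tau>) + norm (inverse (real (Suc n)) *\<^sub>R \<tau>)"
      by (metis add_diff_cancel_right' norm_triangle_ineq4)
    ultimately have "norm (y + inverse (real (Suc n)) *\<^sub>R \<tau>) > r"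
      using y by simp
    moreover have "norm y > r"
      using y norm_ge_zero[of \<tau>] unfolding mem_cball_0 by linarith
    ultimately have "y \<notin> \<Omega>" "y + inverse (real (Suc n)) *\<^sub>R \<tau> \<notin> \<Omega>"
      using r by (auto simp: subset_iff dest!: spec)
    then show ?thesis
      by (simp add: diff_quotient_def zero_outside)
  qed
  then show ?thesis
    using that[of "cball 0 (r + norm \<tau>)"] by auto
qed

lemma lipschitz_const_nonneg: "0 \<le> L"
  using lipschitz[of "axis 1 1" 0] by (simp add: norm_axis_1)

text \<open>A translation moves the shift from \<open>f\<close> to \<open>\<phi>\<close>. The
  integrals then become ordinary difference quotients at 0 of the function \<open>F\<close>, whose
  derivative there is given by \<open>integral_translate_weak_derivative\<close>.\<close>

lemma diff_quotient_limit_test: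
  assumes "test_function \<Omega> \<phi>"
  shows "(\<lambda>n. integral\<^sup>L lebesgue (\<lambda>y. diff_quotient f \<tau> n y * \<phi> y))
    \<longlonglongrightarrow> integral\<^sup>L lebesgue (\<lambda>y. (D y \<bullet> \<tau>) * \<phi> y)"
proof -
  define F where "F = (\<lambda>s. integral\<^sup>L lebesgue (\<lambda>y. f y * \<phi> (y - s *\<^sub>R \<tau>)))"
  obtain K where K: "compact K" "\<And>x. x \<notin> K \<Longrightarrow> \<phi> x = 0"
    using test_function_support[OF assms] by metis
  have cont: "continuous_on UNIV (\<lambda>y. f (y + z) * \<phi> y)" for z
    by (intro continuous_intros continuous_on_compose2[OF continuous] continuous_on_test_function[OF assms]) auto
  have int: "integrable lebesgue (\<lambda>y. f (y + z) * \<phi> y)" for z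
    by (rule integrable_compact_support[OF cont compact_imp_bounded[OF K(1)]]) (simp add: K(2))
  have F: "F s = integral\<^sup>L lebesgue (\<lambda>y. f (y + s *\<^sub>R \<tau>) * \<phi> y)" for s
  proof -
    have "continuous_on UNIV (\<lambda>y. f y * \<phi> (y - s *\<^sub>R \<tau>))"
      by (intro continuous_intros continuous continuous_on_compose2[OF continuous_on_test_function[OF assms, of UNIV]]) auto
    from lebesgue_integral_translate[OF this, of "s *\<^sub>R \<tau>"]
    show ?thesis by (simp add: F_def)
  qed
  have "(F has_real_derivative integral\<^sup>L lebesgue (\<lambda>y. (D y \<bullet> \<tau>) * \<phi> y)) (at 0)"
    using integral_translate_weak_derivative[OF weak_derivative assms, of 0 \<tau>] assms by (simp add: F_def)
  then have "(\<lambda>h. (F h - F 0) / h) \<midarrow>0\<rightarrow> integral\<^sup>L lebesgue (\<lambda>y. (D y \<bullet> \<tau>) * \<phi> y)"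
    by (simp add: DERIV_def)
  then have "(\<lambda>n. (F (inverse (real (Suc n))) - F 0) / inverse (real (Suc n)))
      \<longlonglongrightarrow> integral\<^sup>L lebesgue (\<lambda>y. (D y \<bullet> \<tau>) * \<phi> y)"
    by (rule filterlim_compose) (intro filterlim_atI LIMSEQ_inverse_real_of_nat, simp)
  moreover have "(F (inverse (real (Suc n))) - F 0) / inverse (real (Suc n))
      = integral\<^sup>L lebesgue (\<lambda>y. diff_quotient f \<tau> n y * \<phi> y)" for n
  proof -
    let ?s = "inverse (real (Suc n))"
    have "F ?s - F 0 = integral\<^sup>L lebesgue (\<lambda>y. f (y + ?s *\<^sub>R \<tau>) * \<phi> y - f y * \<phi> y)"
      unfolding F using int[of "?s *\<^sub>R \<tau>"] int[of 0] by simp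
    then have "(F ?s - F 0) / ?s = integral\<^sup>L lebesgue (\<lambda>y. (f (y + ?s *\<^sub>R \<tau>) * \<phi> y - f y * \<phi> y) * real (Suc n))"
      by (simp add: divide_inverse del: of_nat_Suc)
    also have "(\<lambda>y. (f (y + ?s *\<^sub>R \<tau>) * \<phi> y - f y * \<phi> y) * real (Suc n)) = (\<lambda>y. diff_quotient f \<tau> n y * \<phi> y)"
      by (simp add: diff_quotient_def fun_eq_iff algebra_simps del: of_nat_Suc)
    finally show ?thesis .
  qed
  ultimately show ?thesis by simp
qed

text \<open>Away from the closure of \<open>\<Omega>\<close>, both \<open>y\<close> and its shift
  lie outside \<open>\<Omega>\<close> for large \<open>n\<close>, so the quotient is eventually
  zero. This fits the convention that \<open>D\<close> vanishes outside
  \<open>\<Omega>\<close>.\<close>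

lemma diff_quotient_outside:
  fixes g :: "plane \<Rightarrow> real"
  assumes g: "g \<in> borel_measurable lebesgue" "\<And>x. \<bar>g x\<bar> \<le> C"
  shows "(\<lambda>n. integral\<^sup>L lebesgue (\<lambda>y. diff_quotient f \<tau> n y * (indicator (- \<Omega>) y * g y))) \<longlonglongrightarrow> 0"
proof -
  obtain K where K: "compact K" "\<And>n y. y \<notin> K \<Longrightarrow> diff_quotient f \<tau> n y = 0"
    using diff_quotient_support[of \<tau>] by metis
  have "(\<lambda>n. integral\<^sup>L lebesgue (\<lambda>y. diff_quotient f \<tau> n y * (indicator (- \<Omega>) y * g y))) \<longlonglongrightarrow> integral\<^sup>L lebesgue (\<lambda>y::plane. 0)"
  proof (rule integral_dominated_convergence[where w = "\<lambda>x. (L * norm \<tau> * C) * indicator K x"])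
    show "integrable lebesgue (\<lambda>x. (L * norm \<tau> * C) * indicator K x)"
      using lmeasurable_compact[OF K(1)] by (intro integrable_mult_right) (simp add: lmeasurable_iff_integrable)
    show "(\<lambda>y. diff_quotient f \<tau> n y * (indicator (- \<Omega>) y * g y)) \<in> borel_measurable lebesgue" for n
      using borel_measurable_continuous_onI[OF continuous_diff_quotient[of \<tau> n]] open_domain g(1)
      by (intro borel_measurable_times borel_measurable_indicator) (auto simp: measurable_completion)
    show "AE y in lebesgue. norm (diff_quotient f \<tau> n y * (indicator (- \<Omega>) y * g y)) \<le> (L * norm \<tau> * C) * indicator K y" for n
    proof (intro AE_I2)
      fix y
      have "\<bar>diff_quotient f \<tau> n y\<bar> * \<bar>indicator (- \<Omega>) y * g y\<bar> \<le> (L * norm \<tau>) * C"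
        using g(2)[of y] diff_quotient_bound[of \<tau> n y]
        by (intro mult_mono) (auto simp: indicator_def lipschitz_const_nonneg)
      then show "norm (diff_quotient f \<tau> n y * (indicator (- \<Omega>) y * g y)) \<le> (L * norm \<tau> * C) * indicator K y"
        using K(2)[of y n] by (cases "y \<in> K") (auto simp: abs_mult)
    qed
    have "AE y in lebesgue. y \<notin> frontier \<Omega>"
      using negligible_frontier by (simp add: negligible_iff_null_sets AE_not_in)
    then show "AE y in lebesgue. (\<lambda>n. diff_quotient f \<tau> n y * (indicator (- \<Omega>) y * g y)) \<longlonglongrightarrow> 0"
    proof (rule AE_mp, intro AE_I2 impI)
      fix y assume y: "y \<notin> frontier \<Omega>"
      show "(\<lambda>n. diff_quotient f \<tau> n y * (indicator (- \<Omega>) y * g y)) \<longlonglongrightarrow> 0"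
      proof (cases "y \<in> \<Omega>")
        case False
        then have "y \<in> - closure \<Omega>"
          using y open_domain by (auto simp: frontier_def interior_open)
        moreover have "(\<lambda>n. y + inverse (real (Suc n)) *\<^sub>R \<tau>) \<longlonglongrightarrow> y + 0 *\<^sub>R \<tau>"
          by (intro tendsto_intros LIMSEQ_inverse_real_of_nat)
        ultimately have "\<forall>\<^sub>F n in sequentially. y + inverse (real (Suc n)) *\<^sub>R \<tau> \<in> - closure \<Omega>"
          by (intro topological_tendstoD) auto
        then have "\<forall>\<^sub>F n in sequentially. diff_quotient f \<tau> n y * (indicator (- \<Omega>) y * g y) = 0"
        proof (rule eventually_mono)
          fix n assume "y + inverse (real (Suc n)) *\<^sub>R \<tau> \<in> - closure \<Omega>"
          then have "y + inverse (real (Suc n)) *\<^sub>R \<tau> \<notin> \<Omega>"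
            using closure_subset by auto
          then show "diff_quotient f \<tau> n y * (indicator (- \<Omega>) y * g y) = 0"
            using False by (simp add: diff_quotient_def zero_outside)
        qed
        then show ?thesis by (rule tendsto_eventually)
      qed simp
    qed
  qed simp
  then show ?thesis by simp
qed

lemma derivative_measurable: "(\<lambda>y. D y \<bullet> \<tau>) \<in> borel_measurable lebesgue"
  using weak_derivative by (auto simp: has_weak_derivative_def intro!: borel_measurable_inner)

lemma derivative_zero_outside: "x \<notin> \<Omega> \<Longrightarrow> D x = 0"
  using weak_derivative by (simp add: has_weak_derivative_def)

lemma derivative_bounded:
  obtains M where "M \<ge> 0" "\<And>y. \<bar>D y \<bullet> \<tau>\<bar> \<le> M"
proof -
  obtain B where B: "\<And>y. norm (D y) \<le> B"
    using weak_derivative by (auto simp: has_weak_derivative_def bounded_iff)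
  have "\<bar>D y \<bullet> \<tau>\<bar> \<le> B * norm \<tau>" for y
    using Cauchy_Schwarz_ineq2[of "D y" \<tau>] mult_right_mono[OF B[of y] norm_ge_zero[of \<tau>]] by linarith
  moreover have "B * norm \<tau> \<ge> 0"
    using order_trans[OF norm_ge_zero B] by simp
  ultimately show ?thesis using that by blast
qed

text \<open>The quotients and the weak derivative share one bound, so an L^1 approximation of the
  multiplier by a test function changes all the integrals by a uniformly small amount.\<close>

lemma diff_quotient_limit:
  fixes g :: "plane \<Rightarrow> real"
  assumes g: "g \<in> borel_measurable lebesgue" "\<And>x. \<bar>g x\<bar> \<le> C"
  shows "(\<lambda>n. integral\<^sup>L lebesgue (\<lambda>y. diff_quotient f \<tau> n y * g y))
    \<longlonglongrightarrow> integral\<^sup>L lebesgue (\<lambda>y. (D y \<bullet> \<tau>) * g y)"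
proof (rule LIMSEQ_I)
  fix r :: real assume "r > 0"
  obtain M where M: "M \<ge> 0" "\<And>y. \<bar>D y \<bullet> \<tau>\<bar> \<le> M"
    using derivative_bounded[of \<tau>] by metis
  define B where "B = L * norm \<tau> + M + 1"
  have "0 \<le> L * norm \<tau>" using lipschitz_const_nonneg by simp
  then have B: "B > 0" "\<bar>diff_quotient f \<tau> n y\<bar> \<le> B" "\<bar>D y \<bullet> \<tau>\<bar> \<le> B" for n y
    using M(1) M(2)[of y] diff_quotient_bound[of \<tau> n y] by (auto simp: B_def)
  \<comment> \<open>The error \<open>r\<close> is split into four: exchanging the multiplier for
    \<open>\<phi>\<close> in the quotient and in the limit, the limit for \<open>\<phi>\<close>
    itself, and the part outside \<open>\<Omega>\<close>.\<close>
  define e where "e = r / (4 * B)"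
  have "e > 0" "B * e = r / 4" using B(1) \<open>r > 0\<close> by (auto simp: e_def)
  obtain \<phi> where \<phi>: "test_function \<Omega> \<phi>" "integral\<^sup>L lebesgue (\<lambda>x. \<bar>indicator \<Omega> x * g x - \<phi> x\<bar>) < e"
    using test_function_dense[OF open_domain bounded_domain g \<open>e > 0\<close>] by metis
  have i1: "integrable lebesgue (\<lambda>x. indicator \<Omega> x * g x)"
    by (rule integrable_bounded_indicator[OF _ g])
      (use open_domain bounded_domain in \<open>simp add: lmeasurable_open\<close>)
  have i2: "integrable lebesgue \<phi>"
    by (rule integrable_test_function[OF \<phi>(1)])
  have bounded_mult: "integrable lebesgue (\<lambda>y. h y * k y)"
    if "integrable lebesgue k" "h \<in> borel_measurable lebesgue" "\<And>y. \<bar>h y\<bar> \<le> B" for h k :: "plane \<Rightarrow> real"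
  proof (rule Bochner_Integration.integrable_bound)
    show "integrable lebesgue (\<lambda>y. B * k y)" using that(1) by simp
    show "AE y in lebesgue. norm (h y * k y) \<le> norm (B * k y)"
      using that(3) B(1) by (intro AE_I2) (simp add: abs_mult mult_right_mono)
  qed (use that in auto)
  have small: "\<bar>integral\<^sup>L lebesgue (\<lambda>y. h y * (indicator \<Omega> y * g y)) - integral\<^sup>L lebesgue (\<lambda>y. h y * \<phi> y)\<bar> < r / 4"
    if h: "h \<in> borel_measurable lebesgue" "\<And>y. \<bar>h y\<bar> \<le> B" for h
  proof -
    have "integral\<^sup>L lebesgue (\<lambda>y. h y * (indicator \<Omega> y * g y)) - integral\<^sup>L lebesgue (\<lambda>y. h y * \<phi> y)
        = integral\<^sup>L lebesgue (\<lambda>y. h y * (indicator \<Omega> y * g y - \<phi> y))"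
      using bounded_mult[OF i1 h] bounded_mult[OF i2 h] by (simp add: right_diff_distrib)
    also have "\<bar>\<dots>\<bar> \<le> integral\<^sup>L lebesgue (\<lambda>y. \<bar>h y * (indicator \<Omega> y * g y - \<phi> y)\<bar>)"
      by (rule integral_abs_bound)
    also have "\<dots> \<le> integral\<^sup>L lebesgue (\<lambda>y. B * \<bar>indicator \<Omega> y * g y - \<phi> y\<bar>)"
    proof (rule integral_mono)
      show "integrable lebesgue (\<lambda>y. \<bar>h y * (indicator \<Omega> y * g y - \<phi> y)\<bar>)"
        using bounded_mult[OF Bochner_Integration.integrable_diff[OF i1 i2] h] by simp
      show "integrable lebesgue (\<lambda>y. B * \<bar>indicator \<Omega> y * g y - \<phi> y\<bar>)"
        using i1 i2 by simp
      show "\<bar>h y * (indicator \<Omega> y * g y - \<phi> y)\<bar> \<le> B * \<bar>indicator \<Omega> y * g y - \<phi> y\<bar>" for y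
        using h(2)[of y] by (simp add: abs_mult mult_right_mono)
    qed
    also have "\<dots> = B * integral\<^sup>L lebesgue (\<lambda>y. \<bar>indicator \<Omega> y * g y - \<phi> y\<bar>)"
      by simp
    also have "\<dots> < B * e"
      using \<phi>(2) B(1) by (intro mult_strict_left_mono)
    finally show ?thesis using \<open>B * e = r / 4\<close> by simp
  qed
  have qm: "diff_quotient f \<tau> n \<in> borel_measurable lebesgue" for n
    using borel_measurable_continuous_onI[OF continuous_diff_quotient[of \<tau> n]] by (simp add: measurable_completion)
  obtain K where K: "compact K" "\<And>n y. y \<notin> K \<Longrightarrow> diff_quotient f \<tau> n y = 0"
    using diff_quotient_support[of \<tau>] by metis
  have split: "integral\<^sup>L lebesgue (\<lambda>y. diff_quotient f \<tau> n y * g y) =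
      integral\<^sup>L lebesgue (\<lambda>y. diff_quotient f \<tau> n y * (indicator \<Omega> y * g y))
      + integral\<^sup>L lebesgue (\<lambda>y. diff_quotient f \<tau> n y * (indicator (- \<Omega>) y * g y))" for n
  proof -
    have "- \<Omega> \<inter> K \<in> lmeasurable"
      using open_domain K(1) lmeasurable_compact
      by (metis closed_Compl compact_Int_closed Int_commute)
    from integrable_bounded_indicator[OF this g]
    have "integrable lebesgue (\<lambda>y. diff_quotient f \<tau> n y * (indicator (- \<Omega> \<inter> K) y * g y))"
      by (rule bounded_mult[OF _ qm B(2)])
    also have "(\<lambda>y. diff_quotient f \<tau> n y * (indicator (- \<Omega> \<inter> K) y * g y)) = (\<lambda>y. diff_quotient f \<tau> n y * (indicator (- \<Omega>) y * g y))"
      using K(2) by (auto simp: fun_eq_iff indicator_def)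
    finally have i3: "integrable lebesgue (\<lambda>y. diff_quotient f \<tau> n y * (indicator (- \<Omega>) y * g y))" .
    have "diff_quotient f \<tau> n y * g y = diff_quotient f \<tau> n y * (indicator \<Omega> y * g y) + diff_quotient f \<tau> n y * (indicator (- \<Omega>) y * g y)" for y
      by (simp add: indicator_def)
    then show ?thesis
      using i3 bounded_mult[OF i1 qm B(2), of n] by simp
  qed
  have D: "integral\<^sup>L lebesgue (\<lambda>y. (D y \<bullet> \<tau>) * g y) = integral\<^sup>L lebesgue (\<lambda>y. (D y \<bullet> \<tau>) * (indicator \<Omega> y * g y))"
    by (intro Bochner_Integration.integral_cong refl) (auto simp: indicator_def derivative_zero_outside)
  have "r / 4 > 0" using \<open>r > 0\<close> by simp
  from LIMSEQ_D[OF diff_quotient_limit_test[OF \<phi>(1), of \<tau>] this] LIMSEQ_D[OF diff_quotient_outside[OF g, of \<tau>] this]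
  obtain n1 n2 where
    n1: "\<forall>n\<ge>n1. \<bar>integral\<^sup>L lebesgue (\<lambda>y. diff_quotient f \<tau> n y * \<phi> y) - integral\<^sup>L lebesgue (\<lambda>y. (D y \<bullet> \<tau>) * \<phi> y)\<bar> < r / 4" and
    n2: "\<forall>n\<ge>n2. \<bar>integral\<^sup>L lebesgue (\<lambda>y. diff_quotient f \<tau> n y * (indicator (- \<Omega>) y * g y))\<bar> < r / 4"
    unfolding real_norm_def diff_zero by (elim exE)
  show "\<exists>no. \<forall>n\<ge>no. norm (integral\<^sup>L lebesgue (\<lambda>y. diff_quotient f \<tau> n y * g y) - integral\<^sup>L lebesgue (\<lambda>y. (D y \<bullet> \<tau>) * g y)) < r"
  proof (intro exI allI impI)
    fix n assume "n \<ge> max n1 n2"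
    then have "\<bar>integral\<^sup>L lebesgue (\<lambda>y. diff_quotient f \<tau> n y * \<phi> y) - integral\<^sup>L lebesgue (\<lambda>y. (D y \<bullet> \<tau>) * \<phi> y)\<bar> < r / 4"
      "\<bar>integral\<^sup>L lebesgue (\<lambda>y. diff_quotient f \<tau> n y * (indicator (- \<Omega>) y * g y))\<bar> < r / 4"
      using n1 n2 by simp_all
    moreover have "\<bar>u + w - v\<bar> < r"
      if "\<bar>u' - v'\<bar> < r / 4" "\<bar>w\<bar> < r / 4" "\<bar>u - u'\<bar> < r / 4" "\<bar>v - v'\<bar> < r / 4" for u u' v v' w :: real
      using that by linarith
    ultimately show "norm (integral\<^sup>L lebesgue (\<lambda>y. diff_quotient f \<tau> n y * g y) - integral\<^sup>L lebesgue (\<lambda>y. (D y \<bullet> \<tau>) * g y)) < r"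
      unfolding split D real_norm_def using small[OF qm B(2), of n] small[OF derivative_measurable B(3)] by blast
  qed
qed

text \<open>Take the constant multiplier 1: by translation invariance every difference quotient
  already has integral zero.\<close>

lemma integral_weak_derivative_eq_0: "integral\<^sup>L lebesgue (\<lambda>y. D y \<bullet> \<tau>) = 0"
proof -
  have int: "integrable lebesgue f"
    by (rule integrable_compact_support[OF continuous bounded_domain]) (rule zero_outside)
  have c: "continuous_on UNIV (\<lambda>y. f (y + z))" for z
    by (intro continuous_intros continuous_on_compose2[OF continuous]) auto
  have "integral\<^sup>L lebesgue (\<lambda>y. diff_quotient f \<tau> n y * 1) = 0" for n
  proof -
    let ?z = "inverse (real (Suc n)) *\<^sub>R \<tau>"
    have "bounded ((\<lambda>y. y - ?z) ` \<Omega>)"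
      using bounded_translation_minus[OF bounded_domain] .
    then have "integrable lebesgue (\<lambda>y. f (y + ?z))"
    proof (rule integrable_compact_support[OF c])
      show "f (y + ?z) = 0" if "y \<notin> (\<lambda>y. y - ?z) ` \<Omega>" for y
        using that by (intro zero_outside) (auto simp: image_iff)
    qed
    then show ?thesis
      unfolding diff_quotient_def using int lebesgue_integral_translate[OF continuous, of ?z]
      by (simp del: of_nat_Suc)
  qed
  moreover have "(\<lambda>n. integral\<^sup>L lebesgue (\<lambda>y. diff_quotient f \<tau> n y * 1)) \<longlonglongrightarrow> integral\<^sup>L lebesgue (\<lambda>y. (D y \<bullet> \<tau>) * 1)"
    by (rule diff_quotient_limit[where C = 1]) auto
  ultimately show ?thesis
    by (simp add: LIMSEQ_const_iff)
qed

end

text \<open>After expanding the products, corresponding terms differ by a translation of the variable.\<close>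

lemma diff_quotient_exchange:
  assumes a: "continuous_on UNIV a" "bounded \<Omega>" "\<And>x. x \<notin> \<Omega> \<Longrightarrow> a x = 0"
    and b: "continuous_on UNIV b"
  shows "integral\<^sup>L lebesgue (\<lambda>y. diff_quotient a \<sigma> n y * diff_quotient b \<tau> m y)
    = integral\<^sup>L lebesgue (\<lambda>y. diff_quotient a (- \<tau>) m y * diff_quotient b (- \<sigma>) n y)"
proof -
  define s where "s = inverse (real (Suc n)) *\<^sub>R \<sigma>"
  define t where "t = inverse (real (Suc m)) *\<^sub>R \<tau>"
  have c: "continuous_on UNIV (\<lambda>y. a (y + u) * b (y + v))" for u v
    by (intro continuous_intros continuous_on_compose2[OF a(1)] continuous_on_compose2[OF b]) auto
  have i: "integrable lebesgue (\<lambda>y. a (y + u) * b (y + v))" for u v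
  proof (rule integrable_compact_support[OF c bounded_translation_minus[OF a(2), of u]])
    show "a (y + u) * b (y + v) = 0" if "y \<notin> (\<lambda>y. y - u) ` \<Omega>" for y
      using that a(3)[of "y + u"] by (force simp: image_iff)
  qed
  define J where "J = (\<lambda>u v. integral\<^sup>L lebesgue (\<lambda>y. a (y + u) * b (y + v)))"
  have shift: "J u v = J (u - w) (v - w)" for u v w
  proof -
    have "(\<lambda>y. a (y + - w + u) * b (y + - w + v)) = (\<lambda>y. a (y + (u - w)) * b (y + (v - w)))"
      by (simp add: algebra_simps)
    then show ?thesis
      unfolding J_def using lebesgue_integral_translate[OF c[of u v], of "- w"] by simp
  qed
  \<comment> \<open>The summands \<open>+ 0\<close> are kept so that each of the four products is an
    instance of \<open>J\<close>.\<close>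
  have expand: "integral\<^sup>L lebesgue (\<lambda>y. (a (y + u) - a (y + 0)) * (b (y + v) - b (y + 0))) = J u v - J u 0 - J 0 v + J 0 0" for u v
  proof -
    have "integral\<^sup>L lebesgue (\<lambda>y. (a (y + u) - a (y + 0)) * (b (y + v) - b (y + 0)))
      = integral\<^sup>L lebesgue (\<lambda>y. a (y + u) * b (y + v) - a (y + u) * b (y + 0) - a (y + 0) * b (y + v) + a (y + 0) * b (y + 0))"
      by (intro Bochner_Integration.integral_cong refl) (simp add: algebra_simps)
    also have "\<dots> = J u v - J u 0 - J 0 v + J 0 0"
      unfolding J_def using i by (simp del: add_0_right)
    finally show ?thesis .
  qed
  \<comment> \<open>The mixed term is translated by \<open>s + t\<close>, the two terms with a
    single shift by \<open>s\<close> and by \<open>t\<close>. This interchanges the directions and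
    reverses their signs.\<close>
  have "J s t - J s 0 - J 0 t + J 0 0 = J (- t) (- s) - J (- t) 0 - J 0 (- s) + J 0 0"
    using shift[of s t "s + t"] shift[of s 0 s] shift[of 0 t t] by simp
  then have "integral\<^sup>L lebesgue (\<lambda>y. (a (y + s) - a (y + 0)) * (b (y + t) - b (y + 0)))
      = integral\<^sup>L lebesgue (\<lambda>y. (a (y + - t) - a (y + 0)) * (b (y + - s) - b (y + 0)))"
    unfolding expand by simp
  then have "integral\<^sup>L lebesgue (\<lambda>y. (a (y + s) - a (y + 0)) * (b (y + t) - b (y + 0))) * (real (Suc n) * real (Suc m))
      = integral\<^sup>L lebesgue (\<lambda>y. (a (y + - t) - a (y + 0)) * (b (y + - s) - b (y + 0))) * (real (Suc n) * real (Suc m))"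
    by (simp only:)
  then show ?thesis
    unfolding integral_mult_left_zero[symmetric] diff_quotient_def
    by (simp add: s_def t_def mult_ac del: of_nat_Suc)
qed

text \<open>This is double integration by parts without second derivatives. With \<open>m\<close>
  fixed, \<open>n\<close> tends to infinity on both sides of the exchanged identity; only afterwards
  does \<open>m\<close>, with a weak derivative as the multiplier. The two minus signs cancel in the
  end.\<close>

lemma integral_weak_jacobian:
  assumes "lipschitz_zero_trace \<Omega> a Da L" and "lipschitz_zero_trace \<Omega> b Db L'"
  shows "integral\<^sup>L lebesgue (\<lambda>y. (Da y \<bullet> \<sigma>) * (Db y \<bullet> \<tau>)) = integral\<^sup>L lebesgue (\<lambda>y. (Da y \<bullet> \<tau>) * (Db y \<bullet> \<sigma>))"
proof -
  interpret a: lipschitz_zero_trace \<Omega> a Da L by fact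
  interpret b: lipschitz_zero_trace \<Omega> b Db L' by fact
  obtain Ma where Ma: "\<And>y. \<bar>Da y \<bullet> \<sigma>\<bar> \<le> Ma" using a.derivative_bounded[of \<sigma>] by metis
  obtain Mb where Mb: "\<And>y. \<bar>Db y \<bullet> - \<sigma>\<bar> \<le> Mb" using b.derivative_bounded[of "- \<sigma>"] by metis
  have eq: "integral\<^sup>L lebesgue (\<lambda>y. (Da y \<bullet> \<sigma>) * diff_quotient b \<tau> m y)
      = integral\<^sup>L lebesgue (\<lambda>y. (Db y \<bullet> - \<sigma>) * diff_quotient a (- \<tau>) m y)" for m
  proof (rule LIMSEQ_unique)
    have "diff_quotient b \<tau> m \<in> borel_measurable lebesgue"
      using borel_measurable_continuous_onI[OF b.continuous_diff_quotient[of \<tau> m]] by (simp add: measurable_completion)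
    then show "(\<lambda>n. integral\<^sup>L lebesgue (\<lambda>y. diff_quotient a \<sigma> n y * diff_quotient b \<tau> m y)) \<longlonglongrightarrow> integral\<^sup>L lebesgue (\<lambda>y. (Da y \<bullet> \<sigma>) * diff_quotient b \<tau> m y)"
      by (rule a.diff_quotient_limit) (rule b.diff_quotient_bound)
    have "diff_quotient a (- \<tau>) m \<in> borel_measurable lebesgue"
      using borel_measurable_continuous_onI[OF a.continuous_diff_quotient[of "- \<tau>" m]] by (simp add: measurable_completion)
    then have "(\<lambda>n. integral\<^sup>L lebesgue (\<lambda>y. diff_quotient b (- \<sigma>) n y * diff_quotient a (- \<tau>) m y)) \<longlonglongrightarrow> integral\<^sup>L lebesgue (\<lambda>y. (Db y \<bullet> - \<sigma>) * diff_quotient a (- \<tau>) m y)"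
      by (rule b.diff_quotient_limit) (rule a.diff_quotient_bound)
    then show "(\<lambda>n. integral\<^sup>L lebesgue (\<lambda>y. diff_quotient a \<sigma> n y * diff_quotient b \<tau> m y)) \<longlonglongrightarrow> integral\<^sup>L lebesgue (\<lambda>y. (Db y \<bullet> - \<sigma>) * diff_quotient a (- \<tau>) m y)"
      using diff_quotient_exchange[OF a.continuous a.bounded_domain a.zero_outside b.continuous, of \<sigma> _ \<tau> m]
      by (simp add: mult.commute)
  qed
  have 1: "(\<lambda>m. integral\<^sup>L lebesgue (\<lambda>y. diff_quotient b \<tau> m y * (Da y \<bullet> \<sigma>))) \<longlonglongrightarrow> integral\<^sup>L lebesgue (\<lambda>y. (Db y \<bullet> \<tau>) * (Da y \<bullet> \<sigma>))"
    by (rule b.diff_quotient_limit[OF a.derivative_measurable Ma])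
  have 2: "(\<lambda>m. integral\<^sup>L lebesgue (\<lambda>y. diff_quotient a (- \<tau>) m y * (Db y \<bullet> - \<sigma>))) \<longlonglongrightarrow> integral\<^sup>L lebesgue (\<lambda>y. (Da y \<bullet> - \<tau>) * (Db y \<bullet> - \<sigma>))"
    by (rule a.diff_quotient_limit[OF b.derivative_measurable Mb])
  have 3: "(\<lambda>m. integral\<^sup>L lebesgue (\<lambda>y. diff_quotient b \<tau> m y * (Da y \<bullet> \<sigma>))) = (\<lambda>m. integral\<^sup>L lebesgue (\<lambda>y. diff_quotient a (- \<tau>) m y * (Db y \<bullet> - \<sigma>)))"
    using eq by (simp only: mult.commute)
  have "integral\<^sup>L lebesgue (\<lambda>y. (Db y \<bullet> \<tau>) * (Da y \<bullet> \<sigma>)) = integral\<^sup>L lebesgue (\<lambda>y. (Da y \<bullet> - \<tau>) * (Db y \<bullet> - \<sigma>))"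
    by (rule LIMSEQ_unique[OF 1[unfolded 3] 2])
  then show ?thesis by (simp add: mult.commute)
qed

subsection \<open>Lipschitz extension by zero\<close>

lemma norm_transpose_orthogonal_mult:
  fixes Q :: "real ^ 'n ^ 'n"
  assumes "orthogonal_matrix Q"
  shows "norm (transpose Q *v x) = norm x"
  using assms orthogonal_transformation_norm[of "(*v) (transpose Q)"]
  by (simp add: orthogonal_transformation_matrix orthogonal_matrix_transpose)

text \<open>A chart only says where \<open>\<Omega>\<close> is. The points strictly below the graph
  form an open set disjoint from \<open>\<Omega>\<close>, which therefore cannot meet its closure,
  and the points strictly above belong to the open set \<open>\<Omega>\<close> itself.\<close>

lemma lipschitz_chart_frontier:
  assumes chart: "lipschitz_chart \<Omega> x0 Q r g" and "open \<Omega>" and x: "x \<in> frontier \<Omega>" "x \<in> ball x0 r"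
  shows "(Q *v x) $ 2 = g ((Q *v x) $ 1)"
proof (rule antisym)
  have \<Omega>: "\<Omega> \<inter> ball x0 r = {x \<in> ball x0 r. (Q *v x) $ 2 > g ((Q *v x) $ 1)}"
    using chart by (simp add: lipschitz_chart_def)
  have "x \<notin> \<Omega>"
    using x(1) \<open>open \<Omega>\<close> by (simp add: frontier_def interior_open)
  then show "(Q *v x) $ 2 \<le> g ((Q *v x) $ 1)"
    using \<Omega> x(2) by (force simp: not_less)
  obtain L where "L-lipschitz_on UNIV g"
    using chart by (auto simp: lipschitz_chart_def)
  then have g: "continuous_on UNIV g"
    by (rule lipschitz_on_continuous_on)
  show "g ((Q *v x) $ 1) \<le> (Q *v x) $ 2"
  proof (rule ccontr)
    assume neg: "\<not> ?thesis"
    define S where "S = {y. (Q *v y) $ 2 < g ((Q *v y) $ 1)} \<inter> ball x0 r"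
    have "open S"
      unfolding S_def
      by (intro open_Int open_ball open_Collect_less continuous_intros continuous_on_compose2[OF g]
          linear_continuous_on) (auto simp: linear_linear)
    moreover have "x \<in> S"
      using neg x(2) by (simp add: S_def)
    moreover have "S \<inter> \<Omega> = {}"
    proof -
      have "y \<notin> \<Omega>" if "y \<in> S" for y
        using that \<Omega> unfolding S_def by force
      then show ?thesis by blast
    qed
    moreover have "x \<in> closure \<Omega>"
      using x(1) by (simp add: frontier_def)
    ultimately show False
      using open_Int_closure_eq_empty by blast
  qed
qed

text \<open>The graph is the image of the axis y_2 = 0 under a Lipschitz map of the plane to itself,
  namely the graph parametrisation extended independently of y_2.\<close>

lemma negligible_lipschitz_graph:
  fixes Q :: mat2
  assumes Q: "orthogonal_matrix Q" and g: "L-lipschitz_on UNIV g"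
  shows "negligible {x. (Q *v x) $ 2 = g ((Q *v x) $ 1)}"
proof -
  define f where "f = (\<lambda>y::plane. transpose Q *v (vector [y $ 1, g (y $ 1)] :: plane))"
  have "norm (f y - f x) \<le> (1 + L) * norm (y - x)" for x y
  proof -
    have "f y - f x = transpose Q *v (vector [y $ 1, g (y $ 1)] - vector [x $ 1, g (x $ 1)])"
      by (simp add: f_def matrix_vector_mult_diff_distrib)
    then have "norm (f y - f x) = norm (vector [y $ 1, g (y $ 1)] - vector [x $ 1, g (x $ 1)] :: plane)"
      using norm_transpose_orthogonal_mult[OF Q] by simp
    also have "\<dots> \<le> \<bar>y $ 1 - x $ 1\<bar> + \<bar>g (y $ 1) - g (x $ 1)\<bar>"
      using norm_le_l1_cart[of "vector [y $ 1, g (y $ 1)] - vector [x $ 1, g (x $ 1)] :: plane"]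
      by (simp add: sum_2)
    also have "\<dots> \<le> \<bar>y $ 1 - x $ 1\<bar> + L * \<bar>y $ 1 - x $ 1\<bar>"
      using lipschitz_onD[OF g, of "y $ 1" "x $ 1"] by (simp add: dist_real_def)
    also have "\<dots> = (1 + L) * \<bar>(y - x) $ 1\<bar>"
      by (simp add: algebra_simps)
    also have "\<dots> \<le> (1 + L) * norm (y - x)"
      using lipschitz_on_nonneg[OF g] component_le_norm_cart[of "y - x" 1] by (intro mult_left_mono) auto
    finally show ?thesis .
  qed
  then have "negligible (f ` {y. y $ 2 = 0})"
    by (intro negligible_locally_Lipschitz_image negligible_standard_hyperplane_cart) blast+
  moreover have "{x. (Q *v x) $ 2 = g ((Q *v x) $ 1)} \<subseteq> f ` {y. y $ 2 = 0}"
  proof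
    fix x assume "x \<in> {x. (Q *v x) $ 2 = g ((Q *v x) $ 1)}"
    then have "vector [(Q *v x) $ 1, g ((Q *v x) $ 1)] = Q *v x"
      by (simp add: vec_eq_iff forall_2)
    then have "f (vector [(Q *v x) $ 1, 0]) = transpose Q *v (Q *v x)"
      by (simp add: f_def)
    also have "\<dots> = x"
      using Q by (simp add: matrix_vector_mul_assoc orthogonal_matrix_def)
    finally show "x \<in> f ` {y. y $ 2 = 0}"
      by (intro image_eqI[of _ _ "vector [(Q *v x) $ 1, 0]"]) auto
  qed
  ultimately show ?thesis
    by (rule negligible_subset)
qed

text \<open>By compactness finitely many charts cover the frontier, and in each of them it is part
  of a Lipschitz graph.\<close>

lemma negligible_frontier_lipschitz_domain:
  assumes "bounded_lipschitz_domain \<Omega>"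
  shows "negligible (frontier \<Omega>)"
proof -
  have "\<forall>x\<in>frontier \<Omega>. \<exists>r. r > 0 \<and> negligible (frontier \<Omega> \<inter> ball x r)"
  proof
    fix x assume "x \<in> frontier \<Omega>"
    then obtain Q r g where c: "lipschitz_chart \<Omega> x Q r g"
      using assms unfolding bounded_lipschitz_domain_def by blast
    then obtain L where "L-lipschitz_on UNIV g" "orthogonal_matrix Q" "r > 0"
      by (auto simp: lipschitz_chart_def)
    moreover have "frontier \<Omega> \<inter> ball x r \<subseteq> {y. (Q *v y) $ 2 = g ((Q *v y) $ 1)}"
      using lipschitz_chart_frontier[OF c] assms by (auto simp: bounded_lipschitz_domain_def)
    ultimately have "r > 0 \<and> negligible (frontier \<Omega> \<inter> ball x r)"
      using negligible_lipschitz_graph negligible_subset by blast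
    then show "\<exists>r. r > 0 \<and> negligible (frontier \<Omega> \<inter> ball x r)" ..
  qed
  then obtain r where r: "\<forall>x\<in>frontier \<Omega>. r x > 0 \<and> negligible (frontier \<Omega> \<inter> ball x (r x))"
    by (rule bchoice[THEN exE])
  have "compact (frontier \<Omega>)"
    using assms by (simp add: bounded_lipschitz_domain_def compact_frontier_bounded)
  then obtain I where I: "I \<subseteq> frontier \<Omega>" "finite I" "frontier \<Omega> \<subseteq> (\<Union>x\<in>I. ball x (r x))"
  proof (rule compactE_image[of _ "frontier \<Omega>" "\<lambda>x. ball x (r x)"])
    show "frontier \<Omega> \<subseteq> (\<Union>x\<in>frontier \<Omega>. ball x (r x))" using r by force
  qed auto
  have "negligible (\<Union>x\<in>I. frontier \<Omega> \<inter> ball x (r x))"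
    using I r by (intro negligible_Union) auto
  moreover have "frontier \<Omega> \<subseteq> (\<Union>x\<in>I. frontier \<Omega> \<inter> ball x (r x))"
    using I(3) by blast
  ultimately show ?thesis
    by (rule negligible_subset)
qed

section \<open>Weak derivatives of linear combinations and linear functions\<close>

lemma has_weak_derivative_linear_combination:
  assumes f: "has_weak_derivative \<Omega> f D" and g: "has_weak_derivative \<Omega> g E"
  shows "has_weak_derivative \<Omega> (\<lambda>x. \<alpha> * f x + \<beta> * g x) (\<lambda>x. \<alpha> *\<^sub>R D x + \<beta> *\<^sub>R E x)"
  unfolding has_weak_derivative_def
proof (intro conjI allI impI)
  have cont: "continuous_on UNIV f" "continuous_on UNIV g"
    and meas: "D \<in> borel_measurable lebesgue" "E \<in> borel_measurable lebesgue"
    and bdd: "bounded (range D)" "bounded (range E)"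
    using f g by (simp_all add: has_weak_derivative_def)
  show "continuous_on UNIV (\<lambda>x. \<alpha> * f x + \<beta> * g x)"
    by (intro continuous_intros cont)
  show "(\<lambda>x. \<alpha> *\<^sub>R D x + \<beta> *\<^sub>R E x) \<in> borel_measurable lebesgue"
    using meas by simp
  show "bounded (range (\<lambda>x. \<alpha> *\<^sub>R D x + \<beta> *\<^sub>R E x))"
    using bounded_plus_comp[OF bounded_scaleR_comp[OF bdd(1)] bounded_scaleR_comp[OF bdd(2)]] .
  show "\<alpha> *\<^sub>R D x + \<beta> *\<^sub>R E x = 0" if "x \<notin> \<Omega>" for x
    using f g that by (simp add: has_weak_derivative_def)
  fix \<phi> \<tau> assume \<phi>: "test_function \<Omega> \<phi>"
  have if': "integrable lebesgue (\<lambda>x. f x * frechet_derivative \<phi> (at x) \<tau>)" if "continuous_on UNIV f" for f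
  proof -
    obtain K where K: "compact K" "\<And>x. x \<notin> K \<Longrightarrow> frechet_derivative \<phi> (at x) \<tau> = 0"
      using test_function_support[OF \<phi>] by metis
    show ?thesis
      by (rule integrable_compact_support[OF _ compact_imp_bounded[OF K(1)]])
        (intro continuous_intros that continuous_on_frechet_derivative_test_function[OF \<phi>], simp add: K(2))
  qed
  have iD: "integrable lebesgue (\<lambda>x. (D x \<bullet> \<tau>) * \<phi> x)"
    if D: "D \<in> borel_measurable lebesgue" "bounded (range D)" for D :: "plane \<Rightarrow> plane"
  proof -
    obtain B where B: "norm (D x) \<le> B" for x
      using D(2) by (auto simp: bounded_iff)
    show ?thesis
    proof (rule Bochner_Integration.integrable_bound)
      show "integrable lebesgue (\<lambda>x. B * norm \<tau> * \<phi> x)"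
        using integrable_test_function[OF \<phi>] by simp
      show "(\<lambda>x. (D x \<bullet> \<tau>) * \<phi> x) \<in> borel_measurable lebesgue"
        using D(1) integrable_test_function[OF \<phi>]
        by (intro borel_measurable_times borel_measurable_inner) auto
      show "AE x in lebesgue. norm ((D x \<bullet> \<tau>) * \<phi> x) \<le> norm (B * norm \<tau> * \<phi> x)"
      proof (intro AE_I2)
        fix x
        have "\<bar>D x \<bullet> \<tau>\<bar> \<le> B * norm \<tau>"
          using Cauchy_Schwarz_ineq2[of "D x" \<tau>] mult_right_mono[OF B[of x] norm_ge_zero[of \<tau>]] by linarith
        then show "norm ((D x \<bullet> \<tau>) * \<phi> x) \<le> norm (B * norm \<tau> * \<phi> x)"
          unfolding real_norm_def abs_mult[of _ "\<phi> x"] by (intro mult_right_mono) auto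
      qed
    qed
  qed
  have "integral\<^sup>L lebesgue (\<lambda>x. (\<alpha> * f x + \<beta> * g x) * frechet_derivative \<phi> (at x) \<tau>) =
      integral\<^sup>L lebesgue (\<lambda>x. \<alpha> * (f x * frechet_derivative \<phi> (at x) \<tau>) + \<beta> * (g x * frechet_derivative \<phi> (at x) \<tau>))"
    by (simp add: algebra_simps)
  also have "\<dots> = \<alpha> * integral\<^sup>L lebesgue (\<lambda>x. f x * frechet_derivative \<phi> (at x) \<tau>)
      + \<beta> * integral\<^sup>L lebesgue (\<lambda>x. g x * frechet_derivative \<phi> (at x) \<tau>)"
    using if'[OF cont(1)] if'[OF cont(2)] by simp
  also have "\<dots> = - (\<alpha> * integral\<^sup>L lebesgue (\<lambda>x. (D x \<bullet> \<tau>) * \<phi> x) + \<beta> * integral\<^sup>L lebesgue (\<lambda>x. (E x \<bullet> \<tau>) * \<phi> x))"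
    using f g \<phi> by (simp add: has_weak_derivative_def)
  also have "\<dots> = - integral\<^sup>L lebesgue (\<lambda>x. \<alpha> * ((D x \<bullet> \<tau>) * \<phi> x) + \<beta> * ((E x \<bullet> \<tau>) * \<phi> x))"
    using iD[OF meas(1) bdd(1)] iD[OF meas(2) bdd(2)] by simp
  also have "\<dots> = - integral\<^sup>L lebesgue (\<lambda>x. ((\<alpha> *\<^sub>R D x + \<beta> *\<^sub>R E x) \<bullet> \<tau>) * \<phi> x)"
    by (simp add: inner_left_distrib algebra_simps)
  finally show "integral\<^sup>L lebesgue (\<lambda>x. (\<alpha> * f x + \<beta> * g x) * frechet_derivative \<phi> (at x) \<tau>) =
      - integral\<^sup>L lebesgue (\<lambda>x. ((\<alpha> *\<^sub>R D x + \<beta> *\<^sub>R E x) \<bullet> \<tau>) * \<phi> x)" .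
qed

text \<open>Translation evaluates the integral of (a . y) phi(y - s tau) as an affine function of s.
  Comparing its slope with \<open>integral_translate_has_derivative\<close> gives the integration by
  parts.\<close>

lemma has_weak_derivative_inner:
  assumes "open \<Omega>"
  shows "has_weak_derivative \<Omega> (\<lambda>x. a \<bullet> x) (\<lambda>x. if x \<in> \<Omega> then a else 0)"
  unfolding has_weak_derivative_def
proof (intro conjI allI impI)
  show "continuous_on UNIV (\<lambda>x. a \<bullet> x)" by (intro continuous_intros)
  have "\<Omega> \<in> sets lebesgue" using assms by auto
  then show "(\<lambda>x. if x \<in> \<Omega> then a else 0) \<in> borel_measurable lebesgue"
    by (intro measurable_If_set) auto
  show "bounded (range (\<lambda>x. if x \<in> \<Omega> then a else 0))"
    by (rule finite_imp_bounded, rule finite_subset[of _ "{a, 0}"]) auto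
  show "(if x \<in> \<Omega> then a else 0) = 0" if "x \<notin> \<Omega>" for x using that by simp
  fix \<phi> \<tau> assume \<phi>: "test_function \<Omega> \<phi>"
  obtain K where K: "compact K" "K \<subseteq> \<Omega>" "\<And>x. x \<notin> K \<Longrightarrow> \<phi> x = 0"
    using test_function_support[OF \<phi>] by metis
  have c\<phi>: "continuous_on UNIV \<phi>" by (rule continuous_on_test_function[OF \<phi>])
  define I where "I = integral\<^sup>L lebesgue \<phi>"
  define I' where "I' = integral\<^sup>L lebesgue (\<lambda>y. (a \<bullet> y) * \<phi> y)"
  have "integral\<^sup>L lebesgue (\<lambda>y. (a \<bullet> y) * \<phi> (y - s *\<^sub>R \<tau>)) = I' + s * ((a \<bullet> \<tau>) * I)" for s
  proof -
    have "continuous_on UNIV (\<lambda>y. (a \<bullet> y) * \<phi> (y - s *\<^sub>R \<tau>))"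
      by (intro continuous_intros continuous_on_compose2[OF c\<phi>]) auto
    from lebesgue_integral_translate[OF this, of "s *\<^sub>R \<tau>"]
    have "integral\<^sup>L lebesgue (\<lambda>y. (a \<bullet> y) * \<phi> (y - s *\<^sub>R \<tau>)) = integral\<^sup>L lebesgue (\<lambda>y. (a \<bullet> y) * \<phi> y + (s * (a \<bullet> \<tau>)) * \<phi> y)"
      by (simp add: inner_right_distrib distrib_right)
    also have "\<dots> = I' + s * ((a \<bullet> \<tau>) * I)"
    proof -
      have "integrable lebesgue (\<lambda>y. (a \<bullet> y) * \<phi> y)"
        by (rule integrable_compact_support[OF _ compact_imp_bounded[OF K(1)]])
          (intro continuous_intros c\<phi>, simp add: K(3))
      then show ?thesis
        using integrable_test_function[OF \<phi>] by (simp add: I_def I'_def)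
    qed
    finally show ?thesis .
  qed
  then have "((\<lambda>s. I' + s * ((a \<bullet> \<tau>) * I)) has_real_derivative
      - integral\<^sup>L lebesgue (\<lambda>y. (a \<bullet> y) * frechet_derivative \<phi> (at y) \<tau>)) (at 0)"
    using integral_translate_has_derivative[OF \<open>continuous_on UNIV (\<lambda>x. a \<bullet> x)\<close> \<phi>, of \<tau> 0] by simp
  moreover have "((\<lambda>s. I' + s * ((a \<bullet> \<tau>) * I)) has_real_derivative (a \<bullet> \<tau>) * I) (at 0)"
    by (auto intro!: derivative_eq_intros)
  ultimately have "integral\<^sup>L lebesgue (\<lambda>y. (a \<bullet> y) * frechet_derivative \<phi> (at y) \<tau>) = - ((a \<bullet> \<tau>) * I)"
    using DERIV_unique by fastforce
  also have "(a \<bullet> \<tau>) * I = integral\<^sup>L lebesgue (\<lambda>y. (a \<bullet> \<tau>) * \<phi> y)"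
    by (simp add: I_def)
  also have "(\<lambda>y. (a \<bullet> \<tau>) * \<phi> y) = (\<lambda>y. ((if y \<in> \<Omega> then a else 0) \<bullet> \<tau>) * \<phi> y)"
    using K(2,3) by (auto simp: fun_eq_iff)
  finally show "integral\<^sup>L lebesgue (\<lambda>y. (a \<bullet> y) * frechet_derivative \<phi> (at y) \<tau>) =
      - integral\<^sup>L lebesgue (\<lambda>y. ((if y \<in> \<Omega> then a else 0) \<bullet> \<tau>) * \<phi> y)" .
qed

section \<open>Lipschitz bounds inside the domain and across its boundary\<close>

lemma weak_derivative_segment_lipschitz:
  assumes wd: "has_weak_derivative \<Omega> f D" and "open \<Omega>" and M: "\<And>y. norm (D y) \<le> M"
    and "closed_segment x y \<subseteq> \<Omega>"
  shows "\<bar>f x - f y\<bar> \<le> M * norm (x - y)"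
proof -
  have "AE z in lebesgue. z \<in> \<Omega> \<longrightarrow> \<bar>D z \<bullet> (y - x)\<bar> \<le> M * norm (y - x)"
  proof (intro AE_I2 impI)
    fix z
    show "\<bar>D z \<bullet> (y - x)\<bar> \<le> M * norm (y - x)"
      using Cauchy_Schwarz_ineq2[of "D z" "y - x"] mult_right_mono[OF M[of z] norm_ge_zero[of "y - x"]] by linarith
  qed
  from weak_derivative_segment_bound[OF wd \<open>open \<Omega>\<close> order_refl _ this, of x] assms(4)
  show ?thesis by (simp add: norm_minus_commute abs_minus_commute)
qed

text \<open>$p$ is the first point outside $\Omega$ on the way from $x$ to $y$.\<close>

lemma weak_derivative_exit_bound:
  assumes wd: "has_weak_derivative \<Omega> f D" and "open \<Omega>" and zero: "\<And>x. x \<notin> \<Omega> \<Longrightarrow> f x = 0"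
    and M: "\<And>y. norm (D y) \<le> M" and z: "z \<in> closed_segment x y" "z \<notin> \<Omega>"
  obtains p where "p \<in> closed_segment x y" "p \<notin> \<Omega>" "\<bar>f x\<bar> \<le> M * norm (x - p)"
proof -
  define c where "c = (\<lambda>t::real. x + t *\<^sub>R (y - x))"
  have c: "continuous_on UNIV c" unfolding c_def by (intro continuous_intros)
  have f: "continuous_on UNIV f" using wd by (simp add: has_weak_derivative_def)
  define T where "T = {t \<in> {0..1}. c t \<notin> \<Omega>}"
  have "T = {0..1} \<inter> c -` (- \<Omega>)" by (auto simp: T_def)
  then have "compact T"
    using \<open>open \<Omega>\<close> c by (auto intro!: compact_Int_closed closed_vimage)
  obtain s where "0 \<le> s" "s \<le> 1" "z = (1 - s) *\<^sub>R x + s *\<^sub>R y"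
    using z(1) by (auto simp: closed_segment_def)
  then have "c s = z" by (simp add: c_def algebra_simps)
  then have "s \<in> T" using z(2) \<open>0 \<le> s\<close> \<open>s \<le> 1\<close> by (simp add: T_def)
  then obtain t0 where t0: "t0 \<in> T" "\<And>t. t \<in> T \<Longrightarrow> t0 \<le> t"
    using compact_attains_inf[OF \<open>compact T\<close>] by blast
  have t01: "0 \<le> t0" "t0 \<le> 1" "c t0 \<notin> \<Omega>" using t0(1) by (auto simp: T_def)
  have le: "\<bar>f (c t) - f x\<bar> \<le> M * (t * norm (y - x))" if t: "0 \<le> t" "t < t0" for t
  proof -
    have "closed_segment x (x + t *\<^sub>R (y - x)) \<subseteq> \<Omega>"
    proof
      fix w assume "w \<in> closed_segment x (x + t *\<^sub>R (y - x))"
      then obtain u where u: "0 \<le> u" "u \<le> 1" "w = (1 - u) *\<^sub>R x + u *\<^sub>R (x + t *\<^sub>R (y - x))"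
        by (auto simp: closed_segment_def)
      then have "w = c (u * t)" by (simp add: c_def algebra_simps)
      moreover have "u * t \<le> t" using u t by (simp add: mult_left_le_one_le)
      then have "u * t \<notin> T" using t0(2)[of "u * t"] t by auto
      moreover have "u * t \<in> {0..1}" using u t t01 \<open>u * t \<le> t\<close> by auto
      ultimately show "w \<in> \<Omega>" by (auto simp: T_def)
    qed
    from weak_derivative_segment_lipschitz[OF wd \<open>open \<Omega>\<close> M this]
    have "\<bar>f (c t) - f x\<bar> \<le> M * norm (t *\<^sub>R (y - x))"
      by (simp add: c_def abs_minus_commute)
    then show ?thesis using t by simp
  qed
  have "\<bar>f (c t0) - f x\<bar> \<le> M * (t0 * norm (y - x))"
  proof (cases "t0 = 0")
    case True
    then show ?thesis by (simp add: c_def)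
  next
    case False
    \<comment> \<open>The segment up to \<open>c t0\<close> is not contained in
      \<open>\<Omega>\<close>, so the bound at \<open>t0\<close> is a limit of the bounds for
      smaller \<open>t\<close>.\<close>
    have "((\<lambda>t. \<bar>f (c t) - f x\<bar>) \<longlongrightarrow> \<bar>f (c t0) - f x\<bar>) (at_left t0)"
      using continuous_on_compose2[OF f c]
      by (intro tendsto_intros) (auto simp: continuous_on_def intro: tendsto_within_subset)
    moreover have "((\<lambda>t. M * (t * norm (y - x))) \<longlongrightarrow> M * (t0 * norm (y - x))) (at_left t0)"
      by (intro tendsto_intros)
    moreover have "\<forall>\<^sub>F t in at_left t0. \<bar>f (c t) - f x\<bar> \<le> M * (t * norm (y - x))"
      using eventually_at_left_real[of 0 t0] False t01(1) le
      by (auto elim!: eventually_mono)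
    ultimately show ?thesis
      by (intro tendsto_le[OF trivial_limit_at_left_real])
  qed
  moreover have "norm (x - c t0) = t0 * norm (y - x)"
    using t01 by (simp add: c_def)
  moreover have "c t0 \<in> closed_segment x y"
    unfolding closed_segment_def using t01 by (auto simp: c_def algebra_simps intro!: exI[of _ t0])
  ultimately show ?thesis
    using that[of "c t0"] t01(3) zero[of "c t0"] by simp
qed

text \<open>If the segment leaves \<open>\<Omega>\<close>, the values at \<open>x\<close> and
  \<open>y\<close> are compared with zeros of \<open>f\<close> at exit points \<open>p\<close> and
  \<open>q\<close>. Looking for \<open>q\<close> only between \<open>y\<close> and \<open>p\<close>
  keeps the two pieces from overlapping, so their lengths add up to at most
  \<open>norm (x - y)\<close> and the constant is \<open>M\<close> even for a nonconvex
  domain.\<close>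

lemma weak_derivative_lipschitz:
  assumes wd: "has_weak_derivative \<Omega> f D" and "open \<Omega>" and zero: "\<And>x. x \<notin> \<Omega> \<Longrightarrow> f x = 0"
    and M: "\<And>y. norm (D y) \<le> M"
  shows "\<bar>f x - f y\<bar> \<le> M * norm (x - y)"
proof (cases "closed_segment x y \<subseteq> \<Omega>")
  case True
  then show ?thesis
    by (rule weak_derivative_segment_lipschitz[OF wd \<open>open \<Omega>\<close> M])
next
  case False
  then obtain z where z: "z \<in> closed_segment x y" "z \<notin> \<Omega>" by blast
  obtain p where p: "p \<in> closed_segment x y" "p \<notin> \<Omega>" "\<bar>f x\<bar> \<le> M * norm (x - p)"
    by (rule weak_derivative_exit_bound[OF wd \<open>open \<Omega>\<close> zero M z])
  obtain q where q: "q \<in> closed_segment y p" "\<bar>f y\<bar> \<le> M * norm (y - q)"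
    by (rule weak_derivative_exit_bound[OF wd \<open>open \<Omega>\<close> zero M ends_in_segment(2) p(2)])
  have "0 \<le> M" using order_trans[OF norm_ge_zero M] .
  have "norm (y - q) \<le> norm (y - p)"
    using segment_bound(1)[OF q(1)] by (simp add: norm_minus_commute)
  then have "\<bar>f y\<bar> \<le> M * norm (y - p)"
    using q(2) mult_left_mono[OF _ \<open>0 \<le> M\<close>] order_trans by blast
  moreover have "norm (x - y) = norm (x - p) + norm (y - p)"
    using p(1) between_mem_segment[of x y p] between[of x y p] by (simp add: dist_norm norm_minus_commute)
  ultimately have "\<bar>f x\<bar> + \<bar>f y\<bar> \<le> M * norm (x - y)"
    using p(3) by (simp add: distrib_left)
  then show ?thesis by linarith
qed

subsection \<open>Boundary values and strains\<close>

lemma lebesgue_integral_restrict: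
  fixes h :: "plane \<Rightarrow> real"
  assumes "\<Omega> \<in> sets lebesgue" and "\<And>x. x \<notin> \<Omega> \<Longrightarrow> h x = 0"
  shows "integral\<^sup>L (lebesgue_on \<Omega>) h = integral\<^sup>L lebesgue h"
proof -
  have "(\<lambda>x. indicator \<Omega> x *\<^sub>R h x) = h"
    using assms(2) by (auto simp: fun_eq_iff indicator_def)
  then show ?thesis
    using assms(1) by (simp add: integral_restrict_space)
qed

text \<open>Passes from partial derivatives, integrals over \<open>\<Omega>\<close> and
  almost-everywhere bounds to the global notion. Setting row \<open>i\<close> of \<open>Du\<close>
  to zero where the norm exceeds \<open>C\<close> alters it on a null set of \<open>\<Omega>\<close>
  only and makes it bounded everywhere.\<close>

lemma W1_infinity_has_weak_derivative:
  assumes \<Omega>: "open \<Omega>" and W: "W1_infinity \<Omega> u Du" and v: "continuous_on UNIV v"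
    and vu: "AE x in lebesgue_on \<Omega>. v x = u x" and C: "AE x in lebesgue_on \<Omega>. norm (Du x) \<le> C"
  shows "has_weak_derivative \<Omega> (\<lambda>x. v x $ i) (\<lambda>x. if x \<in> \<Omega> \<and> norm (Du x) \<le> C then Du x $ i else 0)"
    (is "has_weak_derivative _ _ ?D")
proof -
  have \<Omega>m: "\<Omega> \<in> sets lebesgue" using \<Omega> by auto
  have um: "u \<in> borel_measurable (lebesgue_on \<Omega>)" and Dum: "Du \<in> borel_measurable (lebesgue_on \<Omega>)"
    and wg: "weak_gradient \<Omega> u Du"
    using W by (auto simp: W1_infinity_def L_infinity_def)
  \<comment> \<open>\<open>Du\<close> is measurable on \<open>\<Omega>\<close> only; measurability
    of \<open>?D\<close> on the plane is obtained through this extension by zero.\<close>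
  define E where "E = (\<lambda>x. indicator \<Omega> x *\<^sub>R Du x)"
  have Em: "E \<in> borel_measurable lebesgue"
    using Dum \<Omega>m unfolding E_def by (subst (asm) borel_measurable_restrict_space_iff) auto
  have nth: "(\<lambda>x::real^'n^'m. x $ k) \<in> borel_measurable borel" for k
    by (intro borel_measurable_continuous_onI continuous_on_component continuous_on_id)
  have nth': "(\<lambda>x::real^'n. x $ k) \<in> borel_measurable borel" for k
    by (intro borel_measurable_continuous_onI continuous_on_component continuous_on_id)
  have DE: "?D = (\<lambda>x. if norm (E x) \<le> C then E x $ i else 0)"
    by (auto simp: E_def fun_eq_iff indicator_def)
  have "{x \<in> space lebesgue. norm (E x) \<le> C} \<in> sets lebesgue"
    using Em by (intro borel_measurable_le borel_measurable_norm) auto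
  then have Dm: "?D \<in> borel_measurable lebesgue"
    unfolding DE using measurable_compose[OF Em nth] by (intro measurable_If) auto
  have D_le: "norm (?D x) \<le> \<bar>C\<bar>" for x
    using Finite_Cartesian_Product.norm_nth_le[of "Du x" i] by (auto intro: order_trans[OF _ abs_ge_self])
  have parts: "integral\<^sup>L lebesgue (\<lambda>x. v x $ i * partial_deriv j \<phi> x) = - integral\<^sup>L lebesgue (\<lambda>x. ?D x $ j * \<phi> x)"
    if \<phi>: "test_function \<Omega> \<phi>" for \<phi> j
  proof -
    obtain K where K: "K \<subseteq> \<Omega>" "\<And>x. x \<notin> K \<Longrightarrow> \<phi> x = 0" "\<And>x \<tau>. x \<notin> K \<Longrightarrow> frechet_derivative \<phi> (at x) \<tau> = 0"
      using test_function_support[OF \<phi>] by metis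
    have pm: "partial_deriv j \<phi> \<in> borel_measurable (lebesgue_on \<Omega>)"
      using borel_measurable_continuous_onI[OF continuous_on_partial_deriv[OF \<phi>, of j]]
      by (intro measurable_restrict_space1 measurable_completion) simp
    have \<phi>m: "\<phi> \<in> borel_measurable (lebesgue_on \<Omega>)"
      using borel_measurable_continuous_onI[OF continuous_on_test_function[OF \<phi>, of UNIV]]
      by (intro measurable_restrict_space1 measurable_completion) simp
    have vm: "v \<in> borel_measurable (lebesgue_on \<Omega>)"
      using borel_measurable_continuous_onI[OF v]
      by (intro measurable_restrict_space1 measurable_completion) simp
    have "integral\<^sup>L lebesgue (\<lambda>x. v x $ i * partial_deriv j \<phi> x) = integral\<^sup>L (lebesgue_on \<Omega>) (\<lambda>x. v x $ i * partial_deriv j \<phi> x)"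
      using K by (intro lebesgue_integral_restrict[OF \<Omega>m, symmetric]) (auto simp: partial_deriv_def)
    also have "\<dots> = integral\<^sup>L (lebesgue_on \<Omega>) (\<lambda>x. u x $ i * partial_deriv j \<phi> x)"
    proof (rule integral_cong_AE)
      show "AE x in lebesgue_on \<Omega>. v x $ i * partial_deriv j \<phi> x = u x $ i * partial_deriv j \<phi> x"
        using vu by (rule AE_mp) (intro AE_I2, simp)
    qed (intro borel_measurable_times measurable_compose[OF vm nth'] measurable_compose[OF um nth'] pm)+
    also have "\<dots> = - integral\<^sup>L (lebesgue_on \<Omega>) (\<lambda>x. Du x $ i $ j * \<phi> x)"
      using wg \<phi> by (simp add: weak_gradient_def)
    also have "integral\<^sup>L (lebesgue_on \<Omega>) (\<lambda>x. Du x $ i $ j * \<phi> x) = integral\<^sup>L (lebesgue_on \<Omega>) (\<lambda>x. ?D x $ j * \<phi> x)"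
    proof (rule integral_cong_AE)
      show "AE x in lebesgue_on \<Omega>. Du x $ i $ j * \<phi> x = ?D x $ j * \<phi> x"
        using C by (rule AE_mp) (intro AE_I2, simp)
      show "(\<lambda>x. Du x $ i $ j * \<phi> x) \<in> borel_measurable (lebesgue_on \<Omega>)"
        by (intro borel_measurable_times measurable_compose[OF measurable_compose[OF Dum nth] nth'] \<phi>m)
      show "(\<lambda>x. ?D x $ j * \<phi> x) \<in> borel_measurable (lebesgue_on \<Omega>)"
        by (intro borel_measurable_times measurable_compose[OF measurable_restrict_space1[OF Dm] nth'] \<phi>m)
    qed
    also have "\<dots> = integral\<^sup>L lebesgue (\<lambda>x. ?D x $ j * \<phi> x)"
      using K by (intro lebesgue_integral_restrict[OF \<Omega>m]) auto
    finally show ?thesis .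
  qed
  have ci: "continuous_on UNIV (\<lambda>x. v x $ i)"
    by (intro continuous_on_component v)
  show ?thesis
    unfolding has_weak_derivative_def
  proof (intro conjI allI impI)
    show "continuous_on UNIV (\<lambda>x. v x $ i)" by (rule ci)
    show "?D \<in> borel_measurable lebesgue" by (rule Dm)
    show "bounded (range ?D)" using D_le by (auto simp only: bounded_iff)
    show "?D x = 0" if "x \<notin> \<Omega>" for x using that by simp
    fix \<phi> \<tau> assume \<phi>: "test_function \<Omega> \<phi>"
    obtain K where K: "compact K" "\<And>x. x \<notin> K \<Longrightarrow> frechet_derivative \<phi> (at x) \<tau> = 0" for \<tau>
      using test_function_support[OF \<phi>] by metis
    have i1: "integrable lebesgue (\<lambda>x. v x $ i * partial_deriv j \<phi> x)" for j
      by (rule integrable_compact_support[OF _ compact_imp_bounded[OF K(1)]])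
        (intro continuous_intros ci continuous_on_partial_deriv[OF \<phi>], simp add: partial_deriv_def K(2))
    have i2: "integrable lebesgue (\<lambda>x. ?D x $ j * \<phi> x)" for j
    proof (rule Bochner_Integration.integrable_bound)
      show "integrable lebesgue (\<lambda>x. \<bar>C\<bar> * \<phi> x)"
        using integrable_test_function[OF \<phi>] by simp
      show "(\<lambda>x. ?D x $ j * \<phi> x) \<in> borel_measurable lebesgue"
        using integrable_test_function[OF \<phi>]
        by (intro borel_measurable_times measurable_compose[OF Dm nth']) auto
      show "AE x in lebesgue. norm (?D x $ j * \<phi> x) \<le> norm (\<bar>C\<bar> * \<phi> x)"
      proof (intro AE_I2)
        fix x
        show "norm (?D x $ j * \<phi> x) \<le> norm (\<bar>C\<bar> * \<phi> x)"
          unfolding norm_mult using order_trans[OF component_le_norm_cart D_le, of x j]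
          by (intro mult_right_mono) auto
      qed
    qed
    have "integral\<^sup>L lebesgue (\<lambda>x. v x $ i * frechet_derivative \<phi> (at x) \<tau>)
        = integral\<^sup>L lebesgue (\<lambda>x. \<Sum>j\<in>UNIV. \<tau> $ j * (v x $ i * partial_deriv j \<phi> x))"
      unfolding frechet_derivative_test_function[OF \<phi>] by (simp add: sum_distrib_left mult_ac)
    also have "\<dots> = (\<Sum>j\<in>UNIV. \<tau> $ j * integral\<^sup>L lebesgue (\<lambda>x. v x $ i * partial_deriv j \<phi> x))"
      using i1 by simp
    also have "\<dots> = - (\<Sum>j\<in>UNIV. \<tau> $ j * integral\<^sup>L lebesgue (\<lambda>x. ?D x $ j * \<phi> x))"
      by (simp only: parts[OF \<phi>] mult_minus_right sum_negf)
    also have "(\<Sum>j\<in>UNIV. \<tau> $ j * integral\<^sup>L lebesgue (\<lambda>x. ?D x $ j * \<phi> x))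
        = integral\<^sup>L lebesgue (\<lambda>x. \<Sum>j\<in>UNIV. \<tau> $ j * (?D x $ j * \<phi> x))"
      using i2 by (subst Bochner_Integration.integral_sum) auto
    also have "(\<lambda>x. \<Sum>j\<in>UNIV. \<tau> $ j * (?D x $ j * \<phi> x)) = (\<lambda>x. (?D x \<bullet> \<tau>) * \<phi> x)"
      by (simp add: inner_vec_def sum_distrib_left mult_ac)
    finally show "integral\<^sup>L lebesgue (\<lambda>x. v x $ i * frechet_derivative \<phi> (at x) \<tau>) = - integral\<^sup>L lebesgue (\<lambda>x. (?D x \<bullet> \<tau>) * \<phi> x)" .
  qed
qed

text \<open>The bound of the weak derivative serves as the Lipschitz constant.\<close>

lemma lipschitz_zero_traceI:
  assumes "bounded_lipschitz_domain \<Omega>" and "has_weak_derivative \<Omega> f D" and "\<And>x. x \<notin> \<Omega> \<Longrightarrow> f x = 0"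
  obtains L where "lipschitz_zero_trace \<Omega> f D L"
proof -
  have "open \<Omega>" "bounded \<Omega>"
    using assms(1) by (simp_all add: bounded_lipschitz_domain_def)
  obtain L where L: "norm (D y) \<le> L" for y
    using assms(2) by (auto simp: has_weak_derivative_def bounded_iff)
  have "lipschitz_zero_trace \<Omega> f D L"
    using assms(2,3) \<open>open \<Omega>\<close> \<open>bounded \<Omega>\<close> negligible_frontier_lipschitz_domain[OF assms(1)]
      weak_derivative_lipschitz[OF assms(2) \<open>open \<Omega>\<close> assms(3) L]
    by unfold_locales
  then show ?thesis by (rule that)
qed

text \<open>$D_i$ stands for row $i$ of the gradient of $v$.\<close>

lemma det_boundary_values_eq_1:
  fixes F :: mat2
  assumes \<Omega>: "bounded_lipschitz_domain \<Omega>"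
    and D: "\<And>i. has_weak_derivative \<Omega> (\<lambda>x. v x $ i) (D i)"
    and bv: "\<And>x. x \<notin> \<Omega> \<Longrightarrow> v x = F *v x"
    and det: "AE x in lebesgue. x \<in> \<Omega> \<longrightarrow> D 1 x $ 1 * D 2 x $ 2 - D 1 x $ 2 * D 2 x $ 1 = 1"
  shows "det F = 1"
proof -
  have op: "open \<Omega>" "bounded \<Omega>" "\<Omega> \<noteq> {}"
    using \<Omega> by (auto simp: bounded_lipschitz_domain_def)
  define w where "w = (\<lambda>i x. 1 * v x $ i + (- 1) * (F $ i \<bullet> x))"
  define E where "E = (\<lambda>i x. 1 *\<^sub>R D i x + (- 1) *\<^sub>R (if x \<in> \<Omega> then F $ i else 0))"
  have wE: "has_weak_derivative \<Omega> (w i) (E i)" for i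
    unfolding w_def E_def
    by (rule has_weak_derivative_linear_combination[OF D has_weak_derivative_inner[OF op(1)]])
  have w0: "w i x = 0" if "x \<notin> \<Omega>" for i x
    using bv[OF that] by (simp add: w_def matrix_vector_mul_component)
  obtain L1 where L1: "lipschitz_zero_trace \<Omega> (w 1) (E 1) L1"
    by (rule lipschitz_zero_traceI[OF \<Omega> wE w0])
  obtain L2 where L2: "lipschitz_zero_trace \<Omega> (w 2) (E 2) L2"
    by (rule lipschitz_zero_traceI[OF \<Omega> wE w0])
  interpret w1: lipschitz_zero_trace \<Omega> "w 1" "E 1" L1 by (rule L1)
  interpret w2: lipschitz_zero_trace \<Omega> "w 2" "E 2" L2 by (rule L2)
  have zero: "integral\<^sup>L lebesgue (\<lambda>x. E 1 x $ j) = 0" "integral\<^sup>L lebesgue (\<lambda>x. E 2 x $ j) = 0" for j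
    using w1.integral_weak_derivative_eq_0[of "axis j 1"] w2.integral_weak_derivative_eq_0[of "axis j 1"]
    by (simp_all add: inner_axis)
  have jac: "integral\<^sup>L lebesgue (\<lambda>x. E 1 x $ 1 * E 2 x $ 2) = integral\<^sup>L lebesgue (\<lambda>x. E 1 x $ 2 * E 2 x $ 1)"
    using integral_weak_jacobian[OF L1 L2, of "axis 1 1" "axis 2 1"] by (simp add: inner_axis)
  have \<Omega>m: "\<Omega> \<in> lmeasurable" using op by (simp add: lmeasurable_open)
  have E0: "E i x = 0" if "x \<notin> \<Omega>" for i x
    using wE[of i] that by (simp add: has_weak_derivative_def)
  have Em: "(\<lambda>x. E i x $ j) \<in> borel_measurable lebesgue" for i j
  proof -
    have "(\<lambda>x. E i x \<bullet> axis j 1) \<in> borel_measurable lebesgue"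
      using wE[of i] by (intro borel_measurable_inner) (auto simp: has_weak_derivative_def)
    then show ?thesis by (simp add: inner_axis)
  qed
  obtain B where B: "\<bar>E i x $ j\<bar> \<le> B i" for i x j
  proof -
    have "\<exists>b. \<forall>x. norm (E i x) \<le> b" for i
      using wE[of i] by (auto simp: has_weak_derivative_def bounded_iff)
    then obtain b where "norm (E i x) \<le> b i" for i x by metis
    then have "\<bar>E i x $ j\<bar> \<le> b i" for i x j
      using component_le_norm_cart[of "E i x" j] order_trans by blast
    then show thesis by (rule that)
  qed
  have int1: "integrable lebesgue (\<lambda>x. E i x $ j)" for i j
  proof -
    have "(\<lambda>x. E i x $ j) = (\<lambda>x. indicator \<Omega> x * E i x $ j)"
      using E0 by (auto simp: fun_eq_iff indicator_def)
    then show ?thesis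
      using integrable_bounded_indicator[OF \<Omega>m Em[of i j] B[of i _ j]] by simp
  qed
  have int2: "integrable lebesgue (\<lambda>x. E i x $ j * E k x $ l)" for i j k l
  proof -
    have "(\<lambda>x. E i x $ j * E k x $ l) = (\<lambda>x. indicator \<Omega> x * (E i x $ j * E k x $ l))"
      using E0 by (auto simp: fun_eq_iff indicator_def)
    moreover have "\<bar>E i x $ j * E k x $ l\<bar> \<le> B i * B k" for x
      unfolding abs_mult using B[of i x j] B[of k x l] by (intro mult_mono) auto
    ultimately show ?thesis
      using integrable_bounded_indicator[OF \<Omega>m borel_measurable_times[OF Em[of i j] Em[of k l]], of "B i * B k"] by simp
  qed
  \<comment> \<open>This is det(F + E) - det F, where E has the rows \<open>E 1 x\<close> and
    \<open>E 2 x\<close>. The linear terms integrate to zero and the quadratic ones cancel by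
    \<open>jac\<close>; on \<open>\<Omega>\<close> the sum F + E is the gradient, so there
    \<open>h\<close> equals 1 - det F almost everywhere.\<close>
  define h where "h = (\<lambda>x. F $ 1 $ 1 * E 2 x $ 2 + F $ 2 $ 2 * E 1 x $ 1 - F $ 1 $ 2 * E 2 x $ 1
      - F $ 2 $ 1 * E 1 x $ 2 + E 1 x $ 1 * E 2 x $ 2 - E 1 x $ 2 * E 2 x $ 1)"
  have ih: "integrable lebesgue h"
    unfolding h_def using int1 int2 by simp
  have "integral\<^sup>L lebesgue h = 0"
    unfolding h_def using int1 int2 by (simp add: zero jac)
  moreover have "integral\<^sup>L lebesgue h = integral\<^sup>L lebesgue (\<lambda>x. (1 - det F) * indicator \<Omega> x)"
  proof (rule integral_cong_AE)
    show "h \<in> borel_measurable lebesgue" using ih by simp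
    show "(\<lambda>x. (1 - det F) * indicator \<Omega> x) \<in> borel_measurable lebesgue"
      using \<Omega>m by auto
    show "AE x in lebesgue. h x = (1 - det F) * indicator \<Omega> x"
      using det
    proof (rule AE_mp, intro AE_I2 impI)
      fix x assume d: "x \<in> \<Omega> \<longrightarrow> D 1 x $ 1 * D 2 x $ 2 - D 1 x $ 2 * D 2 x $ 1 = 1"
      show "h x = (1 - det F) * indicator \<Omega> x"
      proof (cases "x \<in> \<Omega>")
        case True
        then have "h x = (D 1 x $ 1 * D 2 x $ 2 - D 1 x $ 2 * D 2 x $ 1) - det F"
          by (simp add: h_def E_def det_2 algebra_simps)
        then show ?thesis using d True by simp
      qed (simp add: h_def E0)
    qed
  qed
  moreover have "integral\<^sup>L lebesgue (\<lambda>x. (1 - det F) * indicator \<Omega> x) = (1 - det F) * measure lebesgue \<Omega>"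
    using \<Omega>m by (simp add: lmeasurable_iff_integrable)
  moreover have "measure lebesgue \<Omega> \<noteq> 0"
    using \<Omega>m op negligible_iff_measure[of \<Omega>] open_not_negligible[OF op(1,3)] by blast
  ultimately show ?thesis by simp
qed

text \<open>$T$ is tangent to the boundary at $x_0$ and $E$ is the vertical direction of the chart. The segment from
  $x_0 + \eta E$ to $x_0 + \eta E + t T$ with $\eta = 2 \epsilon t$ lies above the graph, which deviates from its
  tangent by at most $\epsilon t$.\<close>

lemma tangent_strain_bound:
  fixes F Q :: mat2 and v :: "plane \<Rightarrow> plane"
  assumes chart: "lipschitz_chart \<Omega> x0 Q r g" and \<Omega>: "open \<Omega>" and x0: "x0 \<in> frontier \<Omega>"
    and g: "(g has_real_derivative d) (at ((Q *v x0) $ 1))"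
    and lip: "\<And>x y. norm (v x - v y) \<le> K * norm (x - y)" "0 \<le> K"
    and bv: "\<And>x. x \<notin> \<Omega> \<Longrightarrow> v x = F *v x"
    and \<rho>: "0 < \<rho>" "\<rho> \<le> r" and T: "T = transpose Q *v vector [1, d]"
    and seg: "\<And>x t. 0 < t \<Longrightarrow> closed_segment x (x + t *\<^sub>R T) \<subseteq> \<Omega> \<inter> ball x0 \<rho> \<Longrightarrow> norm (v (x + t *\<^sub>R T) - v x) \<le> t * c"
  shows "norm (F *v T) \<le> c"
proof -
  define E where "E = transpose Q *v (vector [0, 1] :: plane)"
  have Q: "orthogonal_matrix Q" and
    \<Omega>': "\<Omega> \<inter> ball x0 r = {x \<in> ball x0 r. (Q *v x) $ 2 > g ((Q *v x) $ 1)}"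
    using chart by (auto simp: lipschitz_chart_def)
  have QT: "Q *v (transpose Q *v x) = x" for x
    using Q by (simp add: matrix_vector_mul_assoc orthogonal_matrix_def del: transpose_matrix_vector)
  have "norm (vector [0, 1] :: plane) = 1"
    by (simp add: norm_vec_def L2_set_def sum_2)
  then have E: "norm E = 1"
    unfolding E_def norm_transpose_orthogonal_mult[OF Q] .
  define s0 where "s0 = (Q *v x0) $ 1"
  have g0: "(Q *v x0) $ 2 = g s0"
    unfolding s0_def using lipschitz_chart_frontier[OF chart \<Omega> x0] chart by (simp add: lipschitz_chart_def)
  have coord: "(Q *v (x0 + a *\<^sub>R T + b *\<^sub>R E)) $ 1 = s0 + a" "(Q *v (x0 + a *\<^sub>R T + b *\<^sub>R E)) $ 2 = g s0 + a * d + b" for a b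
    by (simp_all add: matrix_vector_right_distrib matrix_vector_mult_scaleR T E_def QT s0_def g0
        del: transpose_matrix_vector)
  have x0_out: "x0 \<notin> \<Omega>"
    using x0 \<Omega> by (simp add: frontier_def interior_open)
  obtain B where B: "B > 0" "\<And>x. norm (F *v x) \<le> B * norm x"
    using linear_bounded_pos[OF matrix_vector_mul_linear[of F]] by blast
  show ?thesis
  proof (rule field_le_epsilon)
    fix e :: real assume "e > 0"
    \<comment> \<open>The errors to come, in units of \<open>\<epsilon> * t\<close>: 3K at the far
      end of the segment, 2K at the near end, and at most B from the vertical offset of the far
      boundary point.\<close>
    define \<epsilon> where "\<epsilon> = e / (5 * K + B)"
    have \<epsilon>: "\<epsilon> > 0" "(5 * K + B) * \<epsilon> = e"
      using \<open>e > 0\<close> lip(2) B(1) by (simp_all add: \<epsilon>_def)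
    have "(g has_derivative (*) d) (at s0)"
      using g by (simp add: has_field_derivative_def s0_def)
    then obtain \<delta> where \<delta>: "\<delta> > 0" "\<And>y. norm (y - s0) < \<delta> \<Longrightarrow> norm (g y - g s0 - d * (y - s0)) \<le> \<epsilon> * norm (y - s0)"
      using \<epsilon>(1) unfolding has_derivative_at_alt by meson
    have g_close: "\<bar>g (s0 + a) - (g s0 + a * d)\<bar> \<le> \<epsilon> * a" if "0 \<le> a" "a < \<delta>" for a
      using \<delta>(2)[of "s0 + a"] that by (simp add: algebra_simps)
    \<comment> \<open>The first bound keeps the linear approximation of \<open>g\<close> valid. The
      second keeps the segment of length \<open>t * norm T\<close>, raised by
      \<open>2 * \<epsilon> * t\<close>, inside the ball.\<close>
    define t where "t = min (\<delta> / 2) (\<rho> / (2 * (norm T + 2 * \<epsilon>)))"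
    have pos: "norm T + 2 * \<epsilon> > 0"
      using \<epsilon>(1) norm_ge_zero[of T] by linarith
    have t: "0 < t" "t < \<delta>"
      using \<delta>(1) \<rho>(1) pos by (auto simp: t_def min_less_iff_disj)
    have "t * (norm T + 2 * \<epsilon>) \<le> \<rho> / (2 * (norm T + 2 * \<epsilon>)) * (norm T + 2 * \<epsilon>)"
      using pos by (intro mult_right_mono) (auto simp: t_def)
    also have "\<dots> = \<rho> / 2"
      using pos by (simp add: field_simps)
    also have "\<dots> < \<rho>"
      using \<rho>(1) by simp
    finally have t_small: "t * norm T + 2 * \<epsilon> * t < \<rho>"
      by (simp add: algebra_simps)
    define \<eta> where "\<eta> = 2 * \<epsilon> * t"
    have \<eta>: "\<eta> > 0" using \<epsilon>(1) t(1) by (simp add: \<eta>_def)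
    have in_ball: "x0 + a *\<^sub>R T + b *\<^sub>R E \<in> ball x0 \<rho>" if "0 \<le> a" "a \<le> t" "\<bar>b\<bar> \<le> \<eta>" for a b
    proof -
      have "norm (a *\<^sub>R T + b *\<^sub>R E) \<le> norm (a *\<^sub>R T) + norm (b *\<^sub>R E)"
        by (rule norm_triangle_ineq)
      also have "\<dots> \<le> t * norm T + \<eta>"
        using that E by (auto intro!: add_mono mult_right_mono)
      also have "\<dots> < \<rho>" using t_small by (simp add: \<eta>_def)
      moreover have "dist x0 (x0 + a *\<^sub>R T + b *\<^sub>R E) = norm (a *\<^sub>R T + b *\<^sub>R E)"
        by (metis add.assoc add_diff_cancel_left' dist_commute dist_norm)
      ultimately show ?thesis by simp
    qed
    define p where "p = x0 + \<eta> *\<^sub>R E"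
    have "closed_segment p (p + t *\<^sub>R T) \<subseteq> \<Omega> \<inter> ball x0 \<rho>"
    proof
      fix z assume "z \<in> closed_segment p (p + t *\<^sub>R T)"
      then obtain u where u: "0 \<le> u" "u \<le> 1" "z = (1 - u) *\<^sub>R p + u *\<^sub>R (p + t *\<^sub>R T)"
        by (auto simp: closed_segment_def)
      then have z: "z = x0 + (u * t) *\<^sub>R T + \<eta> *\<^sub>R E"
        by (simp add: p_def algebra_simps)
      have a: "0 \<le> u * t" "u * t \<le> t"
        using u t by (simp_all add: mult_left_le_one_le)
      then have zb: "z \<in> ball x0 \<rho>"
        unfolding z using \<eta> by (intro in_ball) auto
      have "\<epsilon> * (u * t) \<le> \<epsilon> * t"
        using a \<epsilon>(1) by (intro mult_left_mono) auto
      moreover have "\<bar>g (s0 + u * t) - (g s0 + (u * t) * d)\<bar> \<le> \<epsilon> * (u * t)"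
        by (rule g_close[OF a(1) order_le_less_trans[OF a(2) t(2)]])
      moreover have "\<epsilon> * t < \<eta>"
        using \<epsilon>(1) t(1) by (simp add: \<eta>_def)
      ultimately have "g (s0 + u * t) < g s0 + (u * t) * d + \<eta>"
        by linarith
      then have "(Q *v z) $ 2 > g ((Q *v z) $ 1)"
        unfolding z coord .
      moreover have "z \<in> ball x0 r" using zb \<rho>(2) by auto
      ultimately have "z \<in> \<Omega>" using \<Omega>' by blast
      with zb show "z \<in> \<Omega> \<inter> ball x0 \<rho>" by blast
    qed
    then have 1: "norm (v (p + t *\<^sub>R T) - v p) \<le> t * c"
      by (rule seg[OF t(1)])
    \<comment> \<open>The offset of the graph from its tangent at abscissa \<open>s0 + t\<close>.
      Correcting the tangent point by it gives a point \<open>y\<close> on the graph, hence outside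
      \<open>\<Omega>\<close>, where \<open>v\<close> equals F y.\<close>
    define \<kappa> where "\<kappa> = g (s0 + t) - (g s0 + t * d)"
    have \<kappa>: "\<bar>\<kappa>\<bar> \<le> \<epsilon> * t"
      unfolding \<kappa>_def using g_close[of t] t by simp
    define y where "y = x0 + t *\<^sub>R T + \<kappa> *\<^sub>R E"
    have "y \<in> ball x0 \<rho>"
      unfolding y_def using \<kappa> t(1) \<epsilon>(1) by (intro in_ball) (auto simp: \<eta>_def)
    then have "y \<in> ball x0 r" using \<rho>(2) by auto
    moreover have "\<not> (Q *v y) $ 2 > g ((Q *v y) $ 1)"
      unfolding y_def coord by (simp add: \<kappa>_def)
    ultimately have y_out: "y \<notin> \<Omega>"
      using \<Omega>' by blast
    have "norm (v y - v (p + t *\<^sub>R T)) \<le> K * norm (y - (p + t *\<^sub>R T))"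
      by (rule lip)
    also have "y - (p + t *\<^sub>R T) = (\<kappa> - \<eta>) *\<^sub>R E"
      by (simp add: y_def p_def algebra_simps)
    also have "K * norm \<dots> \<le> K * (3 * \<epsilon> * t)"
      using \<kappa> E \<eta> lip(2) by (intro mult_left_mono) (auto simp: \<eta>_def)
    finally have 2: "norm (v y - v (p + t *\<^sub>R T)) \<le> K * (3 * \<epsilon> * t)" .
    have "norm (v p - v x0) \<le> K * norm (p - x0)"
      by (rule lip)
    then have 3: "norm (v p - v x0) \<le> K * (2 * \<epsilon> * t)"
      using \<eta> E by (simp add: p_def \<eta>_def)
    have "v y - v x0 = (v y - v (p + t *\<^sub>R T)) + (v (p + t *\<^sub>R T) - v p) + (v p - v x0)"
      by simp
    then have "norm (v y - v x0) \<le> norm (v y - v (p + t *\<^sub>R T)) + norm (v (p + t *\<^sub>R T) - v p) + norm (v p - v x0)"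
      by (metis norm_triangle_le norm_triangle_ineq add_right_mono)
    then have 4: "norm (v y - v x0) \<le> K * (3 * \<epsilon> * t) + t * c + K * (2 * \<epsilon> * t)"
      using 1 2 3 by linarith
    have "v y - v x0 = F *v (y - x0)"
      using bv[OF y_out] bv[OF x0_out] by (simp add: matrix_vector_mult_diff_distrib)
    also have "y - x0 = t *\<^sub>R T + \<kappa> *\<^sub>R E"
      by (simp add: y_def)
    also have "F *v \<dots> = t *\<^sub>R (F *v T) + \<kappa> *\<^sub>R (F *v E)"
      by (simp add: matrix_vector_right_distrib matrix_vector_mult_scaleR)
    finally have "t *\<^sub>R (F *v T) = (v y - v x0) - \<kappa> *\<^sub>R (F *v E)"
      by simp
    then have "t * norm (F *v T) = norm ((v y - v x0) - \<kappa> *\<^sub>R (F *v E))"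
      using t(1) by (metis abs_of_pos norm_scaleR)
    also have "\<dots> \<le> norm (v y - v x0) + \<bar>\<kappa>\<bar> * norm (F *v E)"
      using norm_triangle_ineq4[of "v y - v x0" "\<kappa> *\<^sub>R (F *v E)"] by simp
    also have "\<bar>\<kappa>\<bar> * norm (F *v E) \<le> (\<epsilon> * t) * B"
      using \<kappa> B(2)[of E] E by (intro mult_mono) auto
    finally have "t * norm (F *v T) \<le> t * (c + (5 * K + B) * \<epsilon>)"
      using 4 by (simp add: algebra_simps)
    then show "norm (F *v T) \<le> c + e"
      using t(1) \<epsilon>(2) by simp
  qed
qed


section \<open>Rotated wells and the grains near a boundary point\<close>

lemma rotated_M_setD:
  assumes "A \<in> rotated M_set Q" and "Q \<in> SO2"
  shows "det A = 1" and "norm (A *v (Q *v e1)) = 1"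
proof -
  obtain B where B: "A = B ** transpose Q" "det B = 1" "norm (B *v e1) = 1"
    using assms(1) by (auto simp: rotated_def M_set_def)
  have Q: "transpose Q ** Q = mat 1" "det Q = 1"
    using assms(2) by (auto simp: SO2_def rotation_matrix_def orthogonal_matrix_def)
  show "det A = 1"
    using B(1,2) Q(2) by (simp add: det_mul det_transpose)
  have "A *v (Q *v e1) = B *v e1"
    unfolding B(1) matrix_vector_mul_assoc matrix_mul_assoc[symmetric] Q by simp
  then show "norm (A *v (Q *v e1)) = 1"
    using B(3) by simp
qed

lemma rotated_N_setI:
  assumes "det A = 1" and "norm (A *v (Q *v e1)) \<le> 1" and "Q \<in> SO2"
  shows "A \<in> rotated N_set Q"
proof -
  have Q: "Q ** transpose Q = mat 1" "det Q = 1"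
    using assms(3) by (auto simp: SO2_def rotation_matrix_def orthogonal_matrix_def)
  have "A = (A ** Q) ** transpose Q"
    by (simp add: matrix_mul_assoc[symmetric] Q)
  moreover have "A ** Q \<in> N_set"
    using assms(1,2) Q(2) by (simp add: N_set_def det_mul matrix_vector_mul_assoc)
  ultimately show ?thesis
    unfolding rotated_def by blast
qed

lemma value_on_eq:
  assumes "f constant_on A" and "x \<in> A"
  shows "value_on f A = f x"
proof -
  obtain c where c: "\<forall>y\<in>A. f y = c"
    using assms(1) unfolding constant_on_def by (elim exE)
  show ?thesis
    unfolding value_on_def
  proof (rule the_equality)
    show "\<forall>y\<in>A. f y = f x" using c assms(2) by simp
    show "y = f x" if "\<forall>x\<in>A. f x = y" for y using that assms(2) by simp
  qed
qed

text \<open>If \<open>x\<close> were in the closure of another grain, it would be in the frontier of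
  that grain, since \<open>x\<close> lies outside \<open>\<Omega>\<close>, and so be a dual point.
  The finitely many other closures thus miss a ball around \<open>x\<close>; the grains cover
  \<open>\<Omega>\<close> up to a null set, whence "almost everywhere".\<close>

lemma polycrystal_ball_single_grain:
  assumes P: "polycrystal \<Omega> R N G" and i: "i \<in> {1..N}"
    and x: "x \<in> frontier (G i)" "x \<in> frontier \<Omega>" "x \<notin> boundary_dual_points \<Omega> N G"
  obtains \<rho> where "\<rho> > 0" "AE y in lebesgue. y \<in> \<Omega> \<inter> ball x \<rho> \<longrightarrow> y \<in> G i"
proof -
  have "open \<Omega>" and sub: "\<And>l. l \<in> {1..N} \<Longrightarrow> G l \<subseteq> \<Omega>"
    and neg: "negligible (\<Omega> - (\<Union>k\<in>{1..N}. G k))"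
    using P unfolding polycrystal_def bounded_lipschitz_domain_def by blast+
  have "x \<notin> \<Omega>"
    using x(2) \<open>open \<Omega>\<close> by (simp add: frontier_def interior_open)
  have "x \<notin> closure (G l)" if l: "l \<in> {1..N} - {i}" for l
  proof
    assume "x \<in> closure (G l)"
    moreover have "x \<notin> interior (G l)"
      using \<open>x \<notin> \<Omega>\<close> sub[of l] l interior_subset by blast
    ultimately have "x \<in> frontier (G l)"
      by (simp add: frontier_def)
    then have "x \<in> boundary_dual_points \<Omega> N G"
    proof (cases "l < i")
      case True
      then show ?thesis
        using \<open>x \<in> frontier (G l)\<close> x(1,2) i l unfolding boundary_dual_points_def by auto
    next
      case False
      then have "1 \<le> i \<and> i < l \<and> l \<le> N \<and> x \<in> frontier (G i) \<inter> frontier (G l) \<inter> frontier \<Omega>"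
        using \<open>x \<in> frontier (G l)\<close> x(1,2) i l by auto
      then show ?thesis
        unfolding boundary_dual_points_def by blast
    qed
    then show False using x(3) by simp
  qed
  then have "x \<in> - (\<Union>l\<in>{1..N} - {i}. closure (G l))" by blast
  moreover have "open (- (\<Union>l\<in>{1..N} - {i}. closure (G l)))"
    by (intro open_Compl closed_UN) auto
  ultimately obtain \<rho> where \<rho>: "\<rho> > 0" "ball x \<rho> \<subseteq> - (\<Union>l\<in>{1..N} - {i}. closure (G l))"
    using openE by blast
  have other: "y \<notin> G l" if "y \<in> ball x \<rho>" "l \<in> {1..N} - {i}" for y l
    using that \<rho>(2) closure_subset[of "G l"] by blast
  have "AE y in lebesgue. y \<notin> \<Omega> - (\<Union>k\<in>{1..N}. G k)"
    using neg unfolding negligible_iff_null_sets by (rule AE_not_in)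
  then have "AE y in lebesgue. y \<in> \<Omega> \<inter> ball x \<rho> \<longrightarrow> y \<in> G i"
    by (rule AE_mp) (intro AE_I2, use other in blast)
  with \<rho>(1) show ?thesis by (rule that)
qed

theorem proposition1p2:
  fixes \<Omega> :: "plane set" and R :: "plane \<Rightarrow> mat2"
    and N M :: nat and G :: "nat \<Rightarrow> plane set" and J :: "nat set"
  assumes "polycrystal \<Omega> R N G"
    and "boundary_grains N G = {1..M}"
    and "J = {i \<in> {1..M}. \<exists>x \<in> frontier (G i) \<inter> polycrystal_boundary \<Omega> N G.
               \<exists>n. outer_unit_normal_at \<Omega> x n \<and> n \<bullet> (value_on R (G i) *v e1) = 0}"
  shows "attainable_strains \<Omega> R \<subseteq> (\<Inter>i\<in>J. rotated N_set (value_on R (G i)))"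
proof (intro subsetI INT_I)
  fix F i
  assume F: "F \<in> attainable_strains \<Omega> R" and "i \<in> J"
  have "i \<in> boundary_grains N G"
    using \<open>i \<in> J\<close> assms(2,3) by auto
  then have i: "i \<in> {1..N}"
    by (simp add: boundary_grains_def)
  obtain x0 n where x0: "x0 \<in> frontier (G i)" "x0 \<in> polycrystal_boundary \<Omega> N G"
    and n: "outer_unit_normal_at \<Omega> x0 n" "n \<bullet> (value_on R (G i) *v e1) = 0"
    using \<open>i \<in> J\<close> unfolding assms(3) by auto
  have x0': "x0 \<in> frontier \<Omega>" "x0 \<notin> boundary_dual_points \<Omega> N G"
    using x0(2) by (auto simp: polycrystal_boundary_def)
  have \<Omega>: "bounded_lipschitz_domain \<Omega>" and RSO: "\<And>x. x \<in> \<Omega> \<Longrightarrow> R x \<in> SO2"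
    and G: "G i \<subseteq> \<Omega>" "bounded_lipschitz_domain (G i)" "R constant_on G i"
    using assms(1) i unfolding polycrystal_def by blast+
  have op: "open \<Omega>" using \<Omega> by (simp add: bounded_lipschitz_domain_def)
  then have \<Omega>m: "\<Omega> \<in> sets lebesgue" by auto
  define S where "S = value_on R (G i)"
  define \<tau> where "\<tau> = S *v e1"
  have RS: "R x = S" if "x \<in> G i" for x
    unfolding S_def using value_on_eq[OF G(3) that] by simp
  obtain z where "z \<in> G i"
    using G(2) by (auto simp: bounded_lipschitz_domain_def)
  then have S: "S \<in> SO2"
    using RS[of z] RSO[of z] G(1) by auto
  obtain u Du v where W: "W1_infinity \<Omega> u Du"
    and Du: "AE x in lebesgue_on \<Omega>. Du x \<in> rotated M_set (R x)"
    and v: "continuous_on (closure \<Omega>) v" "AE x in lebesgue_on \<Omega>. v x = u x" "\<And>x. x \<in> frontier \<Omega> \<Longrightarrow> v x = F *v x"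
    using F by (auto simp: attainable_strains_def boundary_values_def)
  obtain C where C: "AE x in lebesgue_on \<Omega>. norm (Du x) \<le> C"
    using W by (auto simp: W1_infinity_def L_infinity_def)
  \<comment> \<open>Extending by F x makes \<open>v'\<close> continuous on the plane and v' - F x
    zero outside \<open>\<Omega>\<close>.\<close>
  define v' where "v' = (\<lambda>x. if x \<in> \<Omega> then v x else F *v x)"
  have "continuous_on (closure \<Omega> \<union> - \<Omega>) v'"
    unfolding v'_def
  proof (rule continuous_on_cases)
    show "continuous_on (- \<Omega>) (\<lambda>x. F *v x)"
      by (intro linear_continuous_on) (simp add: linear_linear)
    show "\<forall>x. x \<in> closure \<Omega> \<and> x \<notin> \<Omega> \<or> x \<in> - \<Omega> \<and> x \<in> \<Omega> \<longrightarrow> v x = F *v x"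
      using v(3) op by (auto simp: frontier_def interior_open)
  qed (use v(1) op in \<open>auto simp: closed_Compl\<close>)
  moreover have "closure \<Omega> \<union> - \<Omega> = UNIV"
    using closure_subset[of \<Omega>] by blast
  ultimately have v'_cont: "continuous_on UNIV v'" by simp
  have v'_out: "v' x = F *v x" if "x \<notin> \<Omega>" for x
    using that by (simp add: v'_def)
  have v'_u: "AE x in lebesgue_on \<Omega>. v' x = u x"
    using v(2) by (rule AE_mp) (intro AE_I2, simp add: v'_def)
  define D where "D = (\<lambda>i x. if x \<in> \<Omega> \<and> norm (Du x) \<le> C then Du x $ i else 0)"
  have D: "has_weak_derivative \<Omega> (\<lambda>x. v' x $ k) (D k)" for k
    unfolding D_def by (rule W1_infinity_has_weak_derivative[OF op W v'_cont v'_u C])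
  have DDu: "AE x in lebesgue. x \<in> \<Omega> \<longrightarrow> (\<forall>k. D k x = Du x $ k) \<and> Du x \<in> rotated M_set (R x)"
  proof -
    have "AE x in lebesgue_on \<Omega>. (\<forall>k. D k x = Du x $ k) \<and> Du x \<in> rotated M_set (R x)"
      using C Du by (rule AE_mp[OF _ AE_mp]) (intro AE_I2, simp add: D_def)
    then show ?thesis
      by (rule AE_restrict_space_iff[THEN iffD1, rotated]) (simp add: \<Omega>m)
  qed
  have ae: "AE x in lebesgue. x \<in> \<Omega> \<longrightarrow> D 1 x $ 1 * D 2 x $ 2 - D 1 x $ 2 * D 2 x $ 1 = 1"
    using DDu
  proof (rule AE_mp, intro AE_I2 impI)
    fix x assume a: "x \<in> \<Omega> \<longrightarrow> (\<forall>k. D k x = Du x $ k) \<and> Du x \<in> rotated M_set (R x)" and "x \<in> \<Omega>"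
    then have "det (Du x) = 1" using rotated_M_setD(1) RSO by blast
    then show "D 1 x $ 1 * D 2 x $ 2 - D 1 x $ 2 * D 2 x $ 1 = 1"
      using a \<open>x \<in> \<Omega>\<close> by (simp add: det_2)
  qed
  have detF: "det F = 1"
    by (rule det_boundary_values_eq_1[where v = v' and D = D, OF \<Omega> D v'_out ae])
  obtain K where K: "0 \<le> K" "\<And>x y. norm (v' x - v' y) \<le> K * norm (x - y)"
  proof -
    \<comment> \<open>\<open>v'\<close> need not vanish outside \<open>\<Omega>\<close>, so its
      Lipschitz bound is derived from that of v' - F x.\<close>
    have "\<exists>L. \<forall>x y. \<bar>(v' x - v' y) $ k\<bar> \<le> L * norm (x - y)" for k
    proof -
      have w: "has_weak_derivative \<Omega> (\<lambda>x. 1 * v' x $ k + (- 1) * (F $ k \<bullet> x))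
          (\<lambda>x. 1 *\<^sub>R D k x + (- 1) *\<^sub>R (if x \<in> \<Omega> then F $ k else 0))"
        by (rule has_weak_derivative_linear_combination[OF D has_weak_derivative_inner[OF op]])
      have w0: "1 * v' x $ k + (- 1) * (F $ k \<bullet> x) = 0" if "x \<notin> \<Omega>" for x
        using v'_out[OF that] by (simp add: matrix_vector_mul_component)
      obtain L where "lipschitz_zero_trace \<Omega> (\<lambda>x. 1 * v' x $ k + (- 1) * (F $ k \<bullet> x))
          (\<lambda>x. 1 *\<^sub>R D k x + (- 1) *\<^sub>R (if x \<in> \<Omega> then F $ k else 0)) L"
        by (rule lipschitz_zero_traceI[OF \<Omega> w w0])
      then have L: "\<bar>(v' x $ k - F $ k \<bullet> x) - (v' y $ k - F $ k \<bullet> y)\<bar> \<le> L * norm (x - y)" for x y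
        using lipschitz_zero_trace.lipschitz by fastforce
      have "\<bar>(v' x - v' y) $ k\<bar> \<le> (L + norm (F $ k)) * norm (x - y)" for x y
        using L[of x y] Cauchy_Schwarz_ineq2[of "F $ k" "x - y"]
        by (simp add: inner_diff_right distrib_right)
      then show ?thesis by blast
    qed
    then obtain L where L: "\<And>k x y. \<bar>(v' x - v' y) $ k\<bar> \<le> L k * norm (x - y)" by metis
    have "norm (v' x - v' y) \<le> (\<bar>L 1\<bar> + \<bar>L 2\<bar>) * norm (x - y)" for x y
    proof -
      have "norm (v' x - v' y) \<le> \<bar>(v' x - v' y) $ 1\<bar> + \<bar>(v' x - v' y) $ 2\<bar>"
        using norm_le_l1_cart[of "v' x - v' y"] by (simp add: sum_2)
      also have "\<dots> \<le> L 1 * norm (x - y) + L 2 * norm (x - y)"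
        by (intro add_mono L)
      also have "\<dots> \<le> (\<bar>L 1\<bar> + \<bar>L 2\<bar>) * norm (x - y)"
        unfolding distrib_right by (intro add_mono mult_right_mono) auto
      finally show ?thesis .
    qed
    then show thesis using that[of "\<bar>L 1\<bar> + \<bar>L 2\<bar>"] by simp
  qed
  obtain Q r g d where chart: "lipschitz_chart \<Omega> x0 Q r g"
    and g: "(g has_real_derivative d) (at ((Q *v x0) $ 1))"
    and n_eq: "n = transpose Q *v ((1 / sqrt (1 + d\<^sup>2)) *\<^sub>R vector [d, -1])"
    using n(1) unfolding outer_unit_normal_at_def by blast
  have Q: "orthogonal_matrix Q" and "r > 0"
    using chart by (auto simp: lipschitz_chart_def)
  define T where "T = transpose Q *v (vector [1, d] :: plane)"
  \<comment> \<open>\<open>\<tau>\<close> will turn out to be \<open>p\<close> times the tangent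
    \<open>T\<close>, because the normal condition forces \<open>Q *v \<tau>\<close> to be parallel
    to (1, d). The sign of \<open>p\<close> is free: \<open>\<tau>\<close> may point either way
    along the boundary.\<close>
  define p where "p = (Q *v \<tau>) $ 1"
  have "norm \<tau> = norm (e1 :: plane)"
  proof -
    have "orthogonal_matrix (transpose S)"
      using S by (simp add: SO2_def rotation_matrix_def orthogonal_matrix_transpose)
    from norm_transpose_orthogonal_mult[OF this] show ?thesis
      by (simp add: \<tau>_def transpose_transpose del: transpose_matrix_vector)
  qed
  then have \<tau>1: "norm \<tau> = 1" by simp
  have "n \<bullet> \<tau> = ((1 / sqrt (1 + d\<^sup>2)) *\<^sub>R vector [d, -1]) \<bullet> (Q *v \<tau>)"
    unfolding n_eq by (metis dot_lmul_matrix transpose_matrix_vector)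
  also have "\<dots> = 1 / sqrt (1 + d\<^sup>2) * (d * p - (Q *v \<tau>) $ 2)"
    by (simp add: inner_vec_def sum_2 p_def algebra_simps)
  finally have "1 / sqrt (1 + d\<^sup>2) * (d * p - (Q *v \<tau>) $ 2) = 0"
    using n(2) by (simp add: \<tau>_def S_def)
  moreover have "1 + d\<^sup>2 > 0"
    by (rule add_pos_nonneg) auto
  ultimately have "(Q *v \<tau>) $ 2 = d * p"
    by simp
  then have "Q *v \<tau> = p *\<^sub>R vector [1, d]"
    by (simp add: vec_eq_iff forall_2 p_def)
  then have "transpose Q *v (Q *v \<tau>) = p *\<^sub>R T"
    by (simp add: T_def matrix_vector_mult_scaleR del: transpose_matrix_vector)
  then have \<tau>T: "\<tau> = p *\<^sub>R T"
    using Q by (simp add: matrix_vector_mul_assoc orthogonal_matrix_def)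
  then have pT: "\<bar>p\<bar> * norm T = 1"
    using \<tau>1 by simp
  obtain \<rho>' where \<rho>': "\<rho>' > 0" "AE y in lebesgue. y \<in> \<Omega> \<inter> ball x0 \<rho>' \<longrightarrow> y \<in> G i"
    by (rule polycrystal_ball_single_grain[OF assms(1) i x0(1) x0'])
  define \<rho> where "\<rho> = min \<rho>' r"
  have \<rho>: "0 < \<rho>" "\<rho> \<le> r" using \<rho>'(1) \<open>r > 0\<close> by (auto simp: \<rho>_def)
  have DuT: "AE y in lebesgue. y \<in> \<Omega> \<inter> ball x0 \<rho> \<longrightarrow> (\<forall>k. D k y = Du y $ k) \<and> norm (Du y *v T) = norm T"
    using DDu \<rho>'(2)
  proof (rule AE_mp[OF _ AE_mp], intro AE_I2 impI)
    fix y assume a: "y \<in> \<Omega> \<inter> ball x0 \<rho>' \<longrightarrow> y \<in> G i"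
      and b: "y \<in> \<Omega> \<longrightarrow> (\<forall>k. D k y = Du y $ k) \<and> Du y \<in> rotated M_set (R y)" and y: "y \<in> \<Omega> \<inter> ball x0 \<rho>"
    have "y \<in> G i" using a y by (auto simp: \<rho>_def)
    then have "Du y \<in> rotated M_set S"
      using b y RS[of y] by auto
    from rotated_M_setD(2)[OF this S] have "\<bar>p\<bar> * norm (Du y *v T) = 1"
      by (simp add: \<tau>T[unfolded \<tau>_def] matrix_vector_mult_scaleR)
    then have "norm (Du y *v T) = norm T"
      using pT by (metis mult_cancel_left mult_zero_left zero_neq_one)
    then show "(\<forall>k. D k y = Du y $ k) \<and> norm (Du y *v T) = norm T"
      using b y by blast
  qed
  have "norm (F *v T) \<le> norm T"
  proof (rule tangent_strain_bound[OF chart op x0'(1) g K(2,1) v'_out \<rho> T_def])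
    fix x t assume t: "(0::real) < t" and seg: "closed_segment x (x + t *\<^sub>R T) \<subseteq> \<Omega> \<inter> ball x0 \<rho>"
    \<comment> \<open>Pairing \<open>v'\<close> with its own increment gives a scalar function whose
      increment along the segment is \<open>w \<bullet> w\<close>. Cancelling \<open>norm w\<close>
      then yields the sharp constant, which bounding the two components separately would
      lose.\<close>
    define w where "w = v' (x + t *\<^sub>R T) - v' x"
    have wd: "has_weak_derivative \<Omega> (\<lambda>x. w $ 1 * v' x $ 1 + w $ 2 * v' x $ 2) (\<lambda>x. w $ 1 *\<^sub>R D 1 x + w $ 2 *\<^sub>R D 2 x)"
      by (rule has_weak_derivative_linear_combination[OF D D])
    have "AE y in lebesgue. y \<in> \<Omega> \<inter> ball x0 \<rho> \<longrightarrow> \<bar>(w $ 1 *\<^sub>R D 1 y + w $ 2 *\<^sub>R D 2 y) \<bullet> (t *\<^sub>R T)\<bar> \<le> norm w * (t * norm T)"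
      using DuT
    proof (rule AE_mp, intro AE_I2 impI)
      fix y assume "y \<in> \<Omega> \<inter> ball x0 \<rho> \<longrightarrow> (\<forall>k. D k y = Du y $ k) \<and> norm (Du y *v T) = norm T"
        and "y \<in> \<Omega> \<inter> ball x0 \<rho>"
      then have y: "\<And>k. D k y = Du y $ k" "norm (Du y *v T) = norm T" by auto
      have "(w $ 1 *\<^sub>R D 1 y + w $ 2 *\<^sub>R D 2 y) \<bullet> (t *\<^sub>R T) = t * (w \<bullet> (Du y *v T))"
        by (simp add: y(1) inner_vec_def sum_2 matrix_vector_mult_def algebra_simps)
      also have "\<bar>\<dots>\<bar> \<le> t * (norm w * norm (Du y *v T))"
        using t Cauchy_Schwarz_ineq2[of w "Du y *v T"] by (simp add: abs_mult)
      finally show "\<bar>(w $ 1 *\<^sub>R D 1 y + w $ 2 *\<^sub>R D 2 y) \<bullet> (t *\<^sub>R T)\<bar> \<le> norm w * (t * norm T)"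
        by (simp add: y(2) mult_ac)
    qed
    from weak_derivative_segment_bound[OF wd _ _ seg this]
    have "\<bar>(w $ 1 * v' (x + t *\<^sub>R T) $ 1 + w $ 2 * v' (x + t *\<^sub>R T) $ 2) - (w $ 1 * v' x $ 1 + w $ 2 * v' x $ 2)\<bar> \<le> norm w * (t * norm T)"
      using op by (auto simp: open_Int)
    moreover have "(w $ 1 * v' (x + t *\<^sub>R T) $ 1 + w $ 2 * v' (x + t *\<^sub>R T) $ 2) - (w $ 1 * v' x $ 1 + w $ 2 * v' x $ 2) = w \<bullet> w"
    proof -
      have "v' (x + t *\<^sub>R T) $ k = v' x $ k + w $ k" for k
        by (simp add: w_def)
      then show ?thesis
        by (simp add: inner_vec_def sum_2 algebra_simps)
    qed
    ultimately have "norm w * norm w \<le> norm w * (t * norm T)"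
      by (simp add: dot_square_norm power2_eq_square)
    then show "norm (v' (x + t *\<^sub>R T) - v' x) \<le> t * norm T"
      unfolding w_def[symmetric] using t by (cases "w = 0") auto
  qed
  \<comment> \<open>\<open>T\<close> has abscissa 1 in the chart and need not be a unit vector; the
    factor \<open>\<bar>p\<bar>\<close> rescales the bound to the unit vector
    \<open>\<tau>\<close>.\<close>
  then have "\<bar>p\<bar> * norm (F *v T) \<le> 1"
    using mult_left_mono[of "norm (F *v T)" "norm T" "\<bar>p\<bar>"] pT by simp
  then have "norm (F *v (S *v e1)) \<le> 1"
    unfolding \<tau>_def[symmetric] \<tau>T by (simp add: matrix_vector_mult_scaleR)
  then show "F \<in> rotated N_set (value_on R (G i))"
    using rotated_N_setI[OF detF _ S] by (simp add: S_def)
qed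

end
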